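(* Let $f:\mathbb{C}\to\mathbb{C}$ be a non-constant entire function, let $\Phi\in\mathrm{Aut}(f)$, and suppose that $\Phi$ is uniform (single-valued) over some non-empty open subset $V\subseteq\mathbb{C}$. Then there exist $\theta\in\mathbb{Q}$ and $b\in\mathbb{C}$ such that $\Phi(z)=e^{i\theta\pi}z+b$, where either $\theta\equiv 0 \pmod 2$, or else $$z_0:=\frac{b}{1-e^{i\theta\pi}}$$ satisfies $f'(z_0)=0$, in which case, if $n\ge 2$ is the integer such that $$f'(z_0)=\ldots=f^{(n-1)}(z_0)=0,\qquad f^{(n)}(z_0)\neq 0,$$ then $$\theta\in\left\{\frac{2k}{n}\;\Big|\;k=0,1,\ldots,n-1\right\}.$$
   Context: An automorphic function of $f$ is a (in general many-valued) analytic function $\phi(z)$ solving the automorphic equation $f(\phi(z))=f(z)$; here a many-valued analytic function is understood as the totality of analytic continuations of a holomorphic function element (the complete analytic function, including all its branches), and the equation holds for all of its branches. $\mathrm{Aut}(f)$ denotes the set of all automorphic functions of $f$. Such a function is called uniform over an open set $V$ if it is single-valued over $V$: all of its branches, obtained by every possible analytic continuation, agree over $V$ (it is not merely required that some one branch be a single-valued holomorphic function on $V$). *)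

theory Defs
  imports "HOL-Complex_Analysis.Complex_Analysis"
begin

text \<open>
  A function element \<open>(a, r, \<phi>)\<close> is a function \<open>\<phi>\<close> holomorphic on the disc \<open>ball a r\<close>;
  the values of \<open>\<phi>\<close> outside that disc carry no meaning.
\<close>

type_synonym function_element = "complex \<times> real \<times> (complex \<Rightarrow> complex)"

fun is_function_element :: "function_element \<Rightarrow> bool" where
  "is_function_element (a, r, \<phi>) \<longleftrightarrow> 0 < r \<and> \<phi> holomorphic_on ball a r"

fun direct_continuation :: "function_element \<Rightarrow> function_element \<Rightarrow> bool" where
  "direct_continuation (a, r, \<phi>) (b, s, \<psi>) \<longleftrightarrow>
     is_function_element (a, r, \<phi>) \<and> is_function_element (b, s, \<psi>) \<and>
     ball a r \<inter> ball b s \<noteq> {} \<and> (\<forall>z \<in> ball a r \<inter> ball b s. \<phi> z = \<psi> z)"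

text \<open>
  Weierstrass continuation along finite chains of discs. The resulting set contains, with each
  element, all its re-expansions on other discs and all its representatives off the disc.
\<close>

definition complete_analytic_function :: "function_element \<Rightarrow> function_element set" where
  "complete_analytic_function E = {E'. direct_continuation\<^sup>*\<^sup>* E E'}"

definition many_valued_analytic :: "function_element set \<Rightarrow> bool" where
  "many_valued_analytic \<Phi> \<longleftrightarrow>
     (\<exists>E. is_function_element E \<and> \<Phi> = complete_analytic_function E)"

definition Aut :: "(complex \<Rightarrow> complex) \<Rightarrow> function_element set set" where
  "Aut f = {\<Phi>. many_valued_analytic \<Phi> \<and>
                (\<forall>(a, r, \<phi>) \<in> \<Phi>. \<forall>z \<in> ball a r. f (\<phi> z) = f z)}"

definition branch_values :: "function_element set \<Rightarrow> complex \<Rightarrow> complex set" where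
  "branch_values \<Phi> z = {w. \<exists>(a, r, \<phi>) \<in> \<Phi>. z \<in> ball a r \<and> w = \<phi> z}"

text \<open>
  Exactly one value at each point of \<open>V\<close>, taken over all branches: some branch is defined there,
  and all branches defined there agree. As \<open>V\<close> is open in applications, agreement of
  values is agreement of germs.
\<close>

definition uniform_over :: "function_element set \<Rightarrow> complex set \<Rightarrow> bool" where
  "uniform_over \<Phi> V \<longleftrightarrow> (\<forall>z \<in> V. \<exists>w. branch_values \<Phi> z = {w})"

end

theory Submission
  imports Defs
begin

text \<open>
The idea is to regard \<open>\<Phi>\<close> as a Riemann surface spread over the plane, on which the value \<open>w\<close> of
a branch is a holomorphic function, and to show that functions on the part of the surface over a disc
obey the maximum principle as if that part had no boundary other than the one over the circle.

A branch can be prevented from continuing over a point \<open>z0\<close> in two ways only. Either its values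
approach a finite \<open>w0\<close>; then \<open>f w0 = f z0\<close>, and since \<open>f\<close> is a power map near \<open>z0\<close> and near \<open>w0\<close>
the branch is parametrised by \<open>z = \<alpha> (s ^ n)\<close>, \<open>w = \<gamma> (\<omega> * s ^ m)\<close> with \<open>\<omega> ^ n = 1\<close>
(\<open>ramified_branch_chart\<close>), so \<open>z0\<close> is at worst a branch point. Or its values tend to infinity. A
bounded function on the surface that tends to \<open>0\<close> with \<open>1 / w\<close> is therefore bounded over a disc by
its size near the boundary (\<open>branch_maximum_principle\<close>). The decay can be dispensed with.
The entire function \<open>f\<close> is bounded on a disc \<open>ball c R\<close> but unbounded on the plane, so the
equation \<open>f w = f z\<close> keeps all values \<open>w\<close> over the disc away from some point \<open>p\<close>. Hence
\<open>h = \<eta> / (w - p)\<close> has modulus at most \<open>1\<close> and no zeros, and applying the principle to \<open>h * G ^ k\<close>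
and letting \<open>k\<close> tend to infinity removes the factor \<open>h\<close> (\<open>branch_bound_at_omitted_disc\<close>).

Let \<open>c\<close> lie in the set over which \<open>\<Phi>\<close> is single-valued. A function on the surface that vanishes
over \<open>c\<close> can then be divided by \<open>z - c\<close>, which gives the lemma of Schwarz, and with it the
algorithm of Schur: \<open>h\<close> agrees at \<open>c\<close> to every order with holomorphic functions on \<open>ball c R\<close>
bounded by \<open>1\<close> (\<open>schur_interpolation\<close>). By the inequalities of Cauchy the Taylor series of \<open>h\<close> at
\<open>c\<close> converges in \<open>ball c R\<close>. Therefore the branch \<open>p + \<eta> / h\<close> is meromorphic in this disc. A pole
would map a small disc around it onto a neighbourhood of infinity and so make \<open>f\<close> bounded there. As
\<open>R\<close> is arbitrary, the branch is an entire function \<open>\<Psi>\<close>, and every branch is a part of it.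

Finally \<open>f \<circ> \<Psi> = f\<close> with \<open>\<Psi>\<close> entire. The image of \<open>cball 0 r\<close> cannot contain a circle around \<open>0\<close>
of radius greater than \<open>r\<close>, since \<open>f\<close> would have there a modulus no greater than on \<open>cball 0 r\<close>. So
\<open>\<Psi>\<close> omits on \<open>cball 0 r\<close> two values of modulus \<open>2 * r\<close> and \<open>4 * r\<close>, and the theorem of Schottky
bounds its growth by a linear function: \<open>\<Psi> z = \<alpha> * z + b\<close>. At a fixed point \<open>z0\<close> of a map of this
kind, differentiating \<open>f (\<alpha> * z + b) = f z\<close> gives \<open>\<alpha> ^ n = 1\<close> whenever the derivative of order
\<open>n\<close> of \<open>f\<close> at \<open>z0\<close> is not zero, and this is the stated alternative.
\<close>

section \<open>Continuation of function elements\<close>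

lemma direct_continuation_sym:
  "direct_continuation E E' \<Longrightarrow> direct_continuation E' E"
  by (cases E; cases E') (auto simp: Int_commute)

lemma eq_on_disc_overlap:
  assumes "\<phi> holomorphic_on ball a r" "\<psi> holomorphic_on ball b s"
    and "z0 \<in> ball a r \<inter> ball b s" "\<forall>\<^sub>F z in nhds z0. \<phi> z = \<psi> z"
    and "z \<in> ball a r \<inter> ball b s"
  shows "\<phi> z = (\<psi> z :: complex)"
proof -
  obtain U where U: "open U" "z0 \<in> U" "\<And>z. z \<in> U \<Longrightarrow> \<phi> z = \<psi> z"
    using assms(4) unfolding eventually_nhds by blast
  show ?thesis
  proof (rule analytic_continuation_open[of "U \<inter> (ball a r \<inter> ball b s)" "ball a r \<inter> ball b s" \<phi> \<psi>])
    show "connected (ball a r \<inter> ball b s)"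
      by (intro convex_connected convex_Int convex_ball)
    show "\<phi> holomorphic_on ball a r \<inter> ball b s" "\<psi> holomorphic_on ball a r \<inter> ball b s"
      using assms(1,2) by (auto intro: holomorphic_on_subset)
  qed (use U assms(3,5) in auto)
qed

lemma branch_valuesI:
  "(a, r, \<phi>) \<in> \<Phi> \<Longrightarrow> z \<in> ball a r \<Longrightarrow> \<phi> z \<in> branch_values \<Phi> z"
  unfolding branch_values_def by (auto intro!: bexI[of _ "(a, r, \<phi>)"])

lemma nonconstant_entire_higher_deriv_nonzero:
  fixes f :: "complex \<Rightarrow> complex"
  assumes f: "f holomorphic_on UNIV" "\<not> f constant_on UNIV"
  shows "\<exists>n>0. (deriv ^^ n) f a \<noteq> 0"
proof (rule ccontr)
  assume "\<not> (\<exists>n>0. (deriv ^^ n) f a \<noteq> 0)"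
  then have "f w = f a" for w
    by (intro holomorphic_fun_eq_const_on_connected[OF f(1) open_UNIV connected_UNIV _ UNIV_I UNIV_I]) blast
  with f(2) show False unfolding constant_on_def by blast
qed

text \<open>
With \<open>f z - f a = A z ^ m\<close> for a function \<open>A\<close> that is injective near \<open>a\<close>, the map \<open>\<alpha>\<close> is the
inverse of \<open>A\<close>.
\<close>

lemma local_power_form:
  fixes f :: "complex \<Rightarrow> complex"
  assumes f: "f holomorphic_on UNIV" "\<not> f constant_on UNIV"
  obtains m \<rho> \<alpha> where "(m::nat) > 0" "\<rho> > 0" "\<alpha> holomorphic_on ball 0 \<rho>" "inj_on \<alpha> (ball 0 \<rho>)"
    "\<alpha> 0 = a" "\<And>u. u \<in> ball 0 \<rho> \<Longrightarrow> f (\<alpha> u) = f a + u ^ m"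
proof -
  obtain n0 where n0: "n0 > 0 \<and> (deriv ^^ n0) f a \<noteq> 0"
    using nonconstant_entire_higher_deriv_nonzero[OF f] by blast
  define m where [abs_def]: "m = (LEAST n. n > 0 \<and> (deriv ^^ n) f a \<noteq> 0)"
  have m: "m > 0" "(deriv ^^ m) f a \<noteq> 0"
    using def_LeastI[OF m_def n0] by auto
  have least: "\<And>k. 0 < k \<Longrightarrow> k < m \<Longrightarrow> (deriv ^^ k) f a = 0"
    using def_Least_le[OF m_def] not_le by auto
  obtain g d where d: "0 < d" and g: "g holomorphic_on ball a d"
    and fg: "\<And>w. w \<in> ball a d \<Longrightarrow> f w - f a = ((w - a) * g w) ^ m"
    and g0: "\<And>w. w \<in> ball a d \<Longrightarrow> g w \<noteq> 0"
    by (rule holomorphic_factor_order_of_zero_strong[OF f(1) open_UNIV UNIV_I m]) (use least in auto)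
  define A where "A = (\<lambda>w. (w - a) * g w)"
  have A: "A holomorphic_on ball a d"
    unfolding A_def by (intro holomorphic_intros g)
  have "(g has_field_derivative deriv g a) (at a)"
    using g d by (intro holomorphic_derivI) auto
  then have "(A has_field_derivative (1 * g a + (a - a) * deriv g a)) (at a)"
    unfolding A_def by (auto intro!: derivative_eq_intros)
  then have dA: "deriv A a \<noteq> 0"
    using g0 d by (simp add: DERIV_imp_deriv)
  obtain r where r: "r > 0" "ball a r \<subseteq> ball a d" "open (A ` ball a r)" "inj_on A (ball a r)"
    using has_complex_derivative_locally_invertible[OF A _ open_ball dA] d by auto
  have A': "A holomorphic_on ball a r"
    using A r(2) by (rule holomorphic_on_subset)
  obtain \<alpha> where \<alpha>: "\<alpha> holomorphic_on A ` ball a r" "\<And>z. z \<in> ball a r \<Longrightarrow> \<alpha> (A z) = z"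
    by (rule holomorphic_has_inverse[OF A' open_ball r(4)]) blast
  have Aa: "A a = 0" by (simp add: A_def)
  then have "0 \<in> A ` ball a r"
    using r(1) by force
  then obtain \<rho> where \<rho>: "\<rho> > 0" "ball 0 \<rho> \<subseteq> A ` ball a r"
    using r(3) openE by blast
  show ?thesis
  proof (rule that[OF m(1) \<rho>(1)])
    show "\<alpha> holomorphic_on ball 0 \<rho>"
      using \<alpha>(1) \<rho>(2) by (rule holomorphic_on_subset)
    show "inj_on \<alpha> (ball 0 \<rho>)"
    proof (rule inj_on_subset[OF _ \<rho>(2)])
      show "inj_on \<alpha> (A ` ball a r)"
        using \<alpha>(2) by (auto simp: inj_on_def)
    qed
    show "\<alpha> 0 = a"
      using \<alpha>(2)[of a] Aa r(1) by simp
    fix u :: complex assume "u \<in> ball 0 \<rho>"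
    then obtain z where z: "z \<in> ball a r" "u = A z" using \<rho>(2) by blast
    then have "f z - f a = u ^ m"
      using fg[of z] r(2) by (auto simp: A_def)
    then show "f (\<alpha> u) = f a + u ^ m"
      using \<alpha>(2) z by (simp add: algebra_simps)
  qed
qed

text \<open>
The pairs \<open>(z, w)\<close> with \<open>w \<in> branch_values \<Phi> z\<close> are thought of as points of a Riemann surface over
the plane.
\<close>

locale automorphic_branches =
  fixes f :: "complex \<Rightarrow> complex" and \<Phi> :: "function_element set"
  assumes entire: "f holomorphic_on UNIV"
    and nonconstant: "\<not> f constant_on UNIV"
    and Aut: "\<Phi> \<in> Aut f"
begin

lemma element_holomorphic:
  assumes "(a, r, \<phi>) \<in> \<Phi>"
  shows "0 < r" "\<phi> holomorphic_on ball a r"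
proof -
  obtain E where E: "is_function_element E" "\<Phi> = complete_analytic_function E"
    using Aut unfolding Aut_def many_valued_analytic_def by blast
  then have "direct_continuation\<^sup>*\<^sup>* E (a, r, \<phi>)"
    using assms unfolding complete_analytic_function_def by simp
  then have "is_function_element (a, r, \<phi>)"
  proof (cases rule: rtranclp.cases)
    case (rtrancl_into_rtrancl b)
    then show ?thesis by (cases b) auto
  qed (use E in auto)
  then show "0 < r" "\<phi> holomorphic_on ball a r" by auto
qed

lemma automorphic:
  assumes "(a, r, \<phi>) \<in> \<Phi>" "z \<in> ball a r"
  shows "f (\<phi> z) = f z"
  using assms Aut unfolding Aut_def by auto

lemma automorphic_value: "w \<in> branch_values \<Phi> z \<Longrightarrow> f w = f z"
  using automorphic unfolding branch_values_def by auto

lemma continuation_closed: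
  assumes "E \<in> \<Phi>" "direct_continuation E E'"
  shows "E' \<in> \<Phi>"
proof -
  obtain E0 where "\<Phi> = complete_analytic_function E0"
    using Aut unfolding Aut_def many_valued_analytic_def by blast
  then show ?thesis
    using assms unfolding complete_analytic_function_def by (auto intro: rtranclp.rtrancl_into_rtrancl)
qed

text \<open>
The agreement that \<open>direct_continuation\<close> asks for on all of the overlap of two discs follows from
agreement near one point, the overlap being connected.
\<close>

lemma continuation_by_germ:
  assumes "(a, r, \<phi>) \<in> \<Phi>" "\<psi> holomorphic_on ball b s" "z \<in> ball a r" "z \<in> ball b s"
    and "\<forall>\<^sub>F x in nhds z. \<phi> x = \<psi> x"
  shows "(b, s, \<psi>) \<in> \<Phi>"
proof (rule continuation_closed[OF assms(1)])
  have "0 < s" using assms(4) by (metis ball_empty empty_iff not_le)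
  moreover have "\<phi> x = \<psi> x" if "x \<in> ball a r \<inter> ball b s" for x
    using eq_on_disc_overlap[OF element_holomorphic(2)[OF assms(1)] assms(2) _ assms(5) that] assms by blast
  ultimately show "direct_continuation (a, r, \<phi>) (b, s, \<psi>)"
    using assms element_holomorphic[OF assms(1)] by auto
qed

text \<open>
Here \<open>s\<close> is a coordinate on the surface, with \<open>z = \<zeta> s\<close> and \<open>w = \<beta> s\<close>. A coordinate other than \<open>z\<close>
is what allows a branch to be followed around a branch point.
\<close>

definition parametrises_branch :: "(complex \<Rightarrow> complex) \<Rightarrow> (complex \<Rightarrow> complex) \<Rightarrow> complex \<Rightarrow> bool"
  where "parametrises_branch \<zeta> \<beta> s \<longleftrightarrow>
    (\<exists>(a, r, \<phi>)\<in>\<Phi>. \<zeta> s \<in> ball a r \<and> (\<forall>\<^sub>F s' in nhds s. \<phi> (\<zeta> s') = \<beta> s'))"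

lemma parametrises_branch_value:
  assumes "parametrises_branch \<zeta> \<beta> s"
  shows "\<beta> s \<in> branch_values \<Phi> (\<zeta> s)"
proof -
  obtain a r \<phi> where *: "(a, r, \<phi>) \<in> \<Phi>" "\<zeta> s \<in> ball a r" "\<forall>\<^sub>F s' in nhds s. \<phi> (\<zeta> s') = \<beta> s'"
    using assms unfolding parametrises_branch_def by auto
  from *(3) have "\<phi> (\<zeta> s) = \<beta> s" by (rule eventually_nhds_x_imp_x)
  with branch_valuesI[OF *(1,2)] show ?thesis by simp
qed

text \<open>
Where \<open>\<zeta>\<close> is locally invertible, \<open>\<beta> \<circ> \<iota>\<close> with \<open>\<iota>\<close> a local inverse of \<open>\<zeta>\<close> is a function element,
and it belongs to \<open>\<Phi>\<close> as soon as one of its germs does. So the set of parameters with the property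
is open and closed.
\<close>

lemma parametrises_branch_spreads:
  assumes S: "open S" "connected S"
    and \<zeta>: "\<zeta> holomorphic_on S" "\<And>s. s \<in> S \<Longrightarrow> deriv \<zeta> s \<noteq> 0"
    and \<beta>: "\<beta> holomorphic_on S"
    and s0: "s0 \<in> S" "parametrises_branch \<zeta> \<beta> s0" and "s \<in> S"
  shows "parametrises_branch \<zeta> \<beta> s"
proof (rule connected_induction_simple[OF S(2), where P = "parametrises_branch \<zeta> \<beta>" and a = s0 and b = s])
  fix s assume s: "s \<in> S"
  obtain \<rho> where \<rho>: "\<rho> > 0" "ball s \<rho> \<subseteq> S" "open (\<zeta> ` ball s \<rho>)" "inj_on \<zeta> (ball s \<rho>)"
    using has_complex_derivative_locally_invertible[OF \<zeta>(1) s S(1) \<zeta>(2)[OF s]] by auto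
  have \<zeta>': "\<zeta> holomorphic_on ball s \<rho>"
    using \<zeta>(1) \<rho>(2) by (rule holomorphic_on_subset)
  obtain \<iota> where \<iota>: "\<iota> holomorphic_on \<zeta> ` ball s \<rho>" "\<And>z. z \<in> ball s \<rho> \<Longrightarrow> \<iota> (\<zeta> z) = z"
    by (rule holomorphic_has_inverse[OF \<zeta>' open_ball \<rho>(4)]) blast
  have "\<zeta> s \<in> \<zeta> ` ball s \<rho>" using \<rho>(1) by auto
  then obtain \<tau> where \<tau>: "\<tau> > 0" "ball (\<zeta> s) \<tau> \<subseteq> \<zeta> ` ball s \<rho>"
    using \<rho>(3) openE by blast
  define T where "T = ball s \<rho> \<inter> \<zeta> -` ball (\<zeta> s) \<tau>"
  define \<psi> where "\<psi> = \<beta> \<circ> \<iota>"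
  have T: "open T" unfolding T_def
    by (intro continuous_open_preimage holomorphic_on_imp_continuous_on[OF \<zeta>'] open_ball)
  have \<psi>: "\<psi> holomorphic_on ball (\<zeta> s) \<tau>" unfolding \<psi>_def
  proof (rule holomorphic_on_compose_gen)
    show "\<iota> holomorphic_on ball (\<zeta> s) \<tau>"
      using \<iota>(1) \<tau>(2) by (rule holomorphic_on_subset)
    show "\<beta> holomorphic_on ball s \<rho>"
      using \<beta> \<rho>(2) by (rule holomorphic_on_subset)
    show "\<iota> ` ball (\<zeta> s) \<tau> \<subseteq> ball s \<rho>"
    proof
      fix y assume "y \<in> \<iota> ` ball (\<zeta> s) \<tau>"
      then obtain x where "x \<in> ball s \<rho>" "y = \<iota> (\<zeta> x)" using \<tau>(2) by blast
      then show "y \<in> ball s \<rho>" using \<iota>(2) by simp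
    qed
  qed
  have \<psi>\<zeta>: "\<psi> (\<zeta> x) = \<beta> x" if "x \<in> T" for x
    using that \<iota>(2) by (simp add: T_def \<psi>_def)
  have spread: "parametrises_branch \<zeta> \<beta> y"
    if x: "x \<in> T" and y: "y \<in> T" and Px: "parametrises_branch \<zeta> \<beta> x" for x y
  proof -
    obtain a r \<phi> where \<phi>: "(a, r, \<phi>) \<in> \<Phi>" "\<zeta> x \<in> ball a r"
      "\<forall>\<^sub>F s' in nhds x. \<phi> (\<zeta> s') = \<beta> s'"
      using Px unfolding parametrises_branch_def by auto
    have xim: "\<zeta> x \<in> \<zeta> ` ball s \<rho>" using x by (auto simp: T_def)
    have "isCont \<iota> (\<zeta> x)"
      using holomorphic_on_imp_continuous_on[OF \<iota>(1)] \<rho>(3) xim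
      by (metis continuous_on_eq_continuous_at)
    then have "filterlim \<iota> (nhds (\<iota> (\<zeta> x))) (nhds (\<zeta> x))"
      by (simp add: isCont_def tendsto_at_iff_tendsto_nhds)
    then have "filterlim \<iota> (nhds x) (nhds (\<zeta> x))"
      using \<iota>(2)[of x] x by (simp add: T_def)
    then have "\<forall>\<^sub>F u in nhds (\<zeta> x). \<phi> (\<zeta> (\<iota> u)) = \<beta> (\<iota> u)"
      by (rule eventually_compose_filterlim[OF \<phi>(3)])
    moreover have "\<forall>\<^sub>F u in nhds (\<zeta> x). u \<in> \<zeta> ` ball s \<rho>"
      using \<rho>(3) xim by (rule eventually_nhds_in_open)
    ultimately have "\<forall>\<^sub>F u in nhds (\<zeta> x). \<phi> u = \<psi> u"
    proof eventually_elim
      case (elim u)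
      then show ?case using \<iota>(2) by (auto simp: \<psi>_def)
    qed
    then have "(\<zeta> s, \<tau>, \<psi>) \<in> \<Phi>"
      using continuation_by_germ[OF \<phi>(1) \<psi> \<phi>(2)] x by (simp add: T_def)
    moreover have "\<forall>\<^sub>F s' in nhds y. \<psi> (\<zeta> s') = \<beta> s'"
      using eventually_nhds_in_open[OF T y] by eventually_elim (rule \<psi>\<zeta>)
    ultimately show ?thesis
      using y unfolding parametrises_branch_def T_def by blast
  qed
  have "s \<in> T" using \<rho>(1) \<tau>(1) by (simp add: T_def)
  moreover have "openin (top_of_set S) T"
    using T \<rho>(2) S(1) by (auto simp: T_def openin_open_eq)
  ultimately show "\<exists>T. openin (top_of_set S) T \<and> s \<in> T \<and>
      (\<forall>x\<in>T. \<forall>y\<in>T. parametrises_branch \<zeta> \<beta> x \<longrightarrow> parametrises_branch \<zeta> \<beta> y)"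
    using spread by blast
qed (use assms in auto)

end

section \<open>Local structure of the branches\<close>

lemma complex_nth_root_ball:
  fixes u :: complex
  assumes "n > 0" "cmod u < \<sigma> ^ n" "0 < \<sigma>"
  obtains s where "s ^ n = u" "cmod s < \<sigma>"
proof -
  obtain s where s: "s ^ n = u"
  proof (cases "u = 0")
    case True
    then show ?thesis using that[of 0] assms(1) by simp
  next
    case False
    then have "exp (Ln u / of_nat n) ^ n = u"
      using assms(1) by (simp flip: exp_of_nat_mult)
    then show ?thesis by (rule that)
  qed
  moreover have "cmod s < \<sigma>"
    using assms s by (metis norm_power power_less_imp_less_base less_imp_le)
  ultimately show ?thesis by (rule that)
qed

lemma isCont_eventually_in_open:
  "isCont g s \<Longrightarrow> open T \<Longrightarrow> g s \<in> T \<Longrightarrow> \<forall>\<^sub>F x in nhds s. g x \<in> T"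
  unfolding isCont_def tendsto_at_iff_tendsto_nhds by (rule topological_tendstoD)

context automorphic_branches
begin

text \<open>
The finitely many local pieces of the curve \<open>f w = f z\<close> at \<open>(z0, w0)\<close>. In coordinates \<open>u\<close>, \<open>v\<close> in
which \<open>f\<close> is a power map the curve reads \<open>v ^ n = u ^ m\<close>; putting \<open>u = s ^ n\<close> splits it into the
pieces \<open>v = \<omega> * s ^ m\<close>, one for each \<open>n\<close>-th root of unity \<open>\<omega>\<close>. A branch of \<open>\<Phi>\<close> that
comes close to \<open>(z0, w0)\<close> lies on one of the pieces, and the whole punctured piece then belongs to
\<open>\<Phi>\<close>. The point \<open>s = 0\<close> need not, since \<open>\<Phi>\<close> may be ramified there.
\<close>

lemma ramified_branch_chart:
  assumes "f w0 = f z0" "open U" "z0 \<in> U"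
  obtains \<sigma> \<delta> \<zeta> B where "0 < \<sigma>" "0 < \<delta>" "finite B" "\<zeta> holomorphic_on ball 0 \<sigma>"
    "\<zeta> ` ball 0 \<sigma> \<subseteq> U" "\<And>s. s \<in> ball 0 \<sigma> - {0} \<Longrightarrow> \<zeta> s \<noteq> z0" "ball z0 \<delta> \<subseteq> \<zeta> ` ball 0 \<sigma>"
    "\<zeta> 0 = z0"
    "\<And>e. e > 0 \<Longrightarrow> \<exists>d>0. \<forall>s\<in>ball 0 \<sigma>. \<zeta> s \<in> ball z0 d \<longrightarrow> cmod s < e"
    "\<And>\<beta>. \<beta> \<in> B \<Longrightarrow> \<beta> holomorphic_on ball 0 \<sigma>"
    "\<And>z w. z \<in> ball z0 \<delta> - {z0} \<Longrightarrow> w \<in> ball w0 \<delta> \<Longrightarrow> w \<in> branch_values \<Phi> z \<Longrightarrow>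
       \<exists>\<beta>\<in>B. \<exists>s\<in>ball 0 \<sigma> - {0}. \<zeta> s = z \<and> \<beta> s = w \<and>
         (\<forall>s'\<in>ball 0 \<sigma> - {0}. parametrises_branch \<zeta> \<beta> s')"
proof -
  obtain m \<rho>1 \<alpha> where m: "m > 0" "\<rho>1 > 0" and \<alpha>: "\<alpha> holomorphic_on ball 0 \<rho>1" "inj_on \<alpha> (ball 0 \<rho>1)"
    "\<alpha> 0 = z0" "\<And>u. u \<in> ball 0 \<rho>1 \<Longrightarrow> f (\<alpha> u) = f z0 + u ^ m"
    using local_power_form[OF entire nonconstant, of z0] by blast
  obtain n \<rho>2 \<gamma> where n: "n > 0" "\<rho>2 > 0" and \<gamma>: "\<gamma> holomorphic_on ball 0 \<rho>2" "inj_on \<gamma> (ball 0 \<rho>2)"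
    "\<gamma> 0 = w0" "\<And>u. u \<in> ball 0 \<rho>2 \<Longrightarrow> f (\<gamma> u) = f w0 + u ^ n"
    using local_power_form[OF entire nonconstant, of w0] by blast
  have "open (ball 0 \<rho>1 \<inter> \<alpha> -` U)"
    by (intro continuous_open_preimage holomorphic_on_imp_continuous_on[OF \<alpha>(1)] open_ball assms)
  moreover have "0 \<in> ball 0 \<rho>1 \<inter> \<alpha> -` U" using m \<alpha>(3) assms(3) by simp
  ultimately obtain \<rho> where \<rho>: "\<rho> > 0" "ball 0 \<rho> \<subseteq> ball 0 \<rho>1 \<inter> \<alpha> -` U"
    using openE by blast
  \<comment> \<open>As \<open>\<sigma> \<le> 1\<close>, powers of \<open>s\<close> do not leave \<open>ball 0 \<sigma>\<close>.\<close>
  define \<sigma> where "\<sigma> = min 1 (min \<rho> \<rho>2)"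
  have \<sigma>: "0 < \<sigma>" "\<sigma> \<le> 1" "\<sigma> \<le> \<rho>" "\<sigma> \<le> \<rho>2" using \<rho> n by (auto simp: \<sigma>_def)
  have pow: "s ^ k \<in> ball 0 \<sigma>" if "s \<in> ball 0 \<sigma>" "k > 0" for s :: complex and k
  proof -
    have "cmod s ^ k \<le> cmod s ^ 1"
      using that \<sigma> by (intro power_decreasing) auto
    then show ?thesis using that by (simp add: norm_power)
  qed
  have sub1: "ball 0 \<sigma> \<subseteq> (ball 0 \<rho>1 :: complex set)"
    using \<rho>(2) subset_ball[OF \<sigma>(3), of 0] by blast
  have sub2: "ball 0 \<sigma> \<subseteq> (ball 0 \<rho>2 :: complex set)"
    by (rule subset_ball[OF \<sigma>(4)])
  define \<zeta> where "\<zeta> = (\<lambda>s. \<alpha> (s ^ n))"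
  define \<beta> where "\<beta> = (\<lambda>\<omega> s. \<gamma> (\<omega> * s ^ m))"
  define B where "B = \<beta> ` {\<omega>. \<omega> ^ n = 1}"
  have \<zeta>: "\<zeta> holomorphic_on ball 0 \<sigma>"
  proof -
    have "\<alpha> \<circ> (\<lambda>s. s ^ n) holomorphic_on ball 0 \<sigma>"
      using pow n(1) sub1 by (intro holomorphic_on_compose_gen[OF _ \<alpha>(1)] holomorphic_intros) blast
    then show ?thesis by (simp add: \<zeta>_def comp_def)
  qed
  have \<omega>ball: "\<omega> * s ^ m \<in> ball 0 \<rho>2" if "s \<in> ball 0 \<sigma>" "\<omega> ^ n = 1" for s \<omega> :: complex
  proof -
    have "cmod \<omega> ^ n = 1 ^ n"
      using that(2) by (simp flip: norm_power)
    then have "cmod \<omega> = 1"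
      by (rule power_eq_imp_eq_base) (use n(1) in auto)
    then show ?thesis using pow[OF that(1) m(1)] sub2 by (auto simp: norm_mult)
  qed
  have \<beta>: "\<beta> \<omega> holomorphic_on ball 0 \<sigma>" if "\<omega> ^ n = 1" for \<omega>
  proof -
    have "\<gamma> \<circ> (\<lambda>s. \<omega> * s ^ m) holomorphic_on ball 0 \<sigma>"
      using \<omega>ball that by (intro holomorphic_on_compose_gen[OF _ \<gamma>(1)] holomorphic_intros) blast
    then show ?thesis by (simp add: \<beta>_def comp_def)
  qed
  have image_\<alpha>: "\<exists>d>0. ball z0 d \<subseteq> \<alpha> ` ball 0 e" if "0 < e" "e \<le> \<rho>1" for e
  proof -
    have "ball 0 e \<subseteq> (ball 0 \<rho>1 :: complex set)" by (rule subset_ball[OF that(2)])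
    then have "open (\<alpha> ` ball 0 e)"
      using \<alpha>(1,2) by (intro open_mapping_thm3) (auto intro: holomorphic_on_subset inj_on_subset)
    moreover have "z0 \<in> \<alpha> ` ball 0 e" using that \<alpha>(3) by force
    ultimately show ?thesis using openE by blast
  qed
  have "open (\<gamma> ` ball 0 \<rho>2)" using \<gamma>(1,2) by (intro open_mapping_thm3) auto
  moreover have "w0 \<in> \<gamma> ` ball 0 \<rho>2" using n \<gamma>(3) by force
  ultimately obtain \<delta>2 where \<delta>2: "\<delta>2 > 0" "ball w0 \<delta>2 \<subseteq> \<gamma> ` ball 0 \<rho>2" using openE by blast
  have \<sigma>n: "\<sigma> ^ n \<le> \<sigma>"
    using \<sigma> n power_decreasing[of 1 n \<sigma>] by simp
  have "\<sigma> \<le> \<rho>1"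
    using sub1 \<sigma>(1) by (simp add: ball_subset_ball_iff)
  then obtain \<delta>1 where \<delta>1: "\<delta>1 > 0" "ball z0 \<delta>1 \<subseteq> \<alpha> ` ball 0 (\<sigma> ^ n)"
    using image_\<alpha>[of "\<sigma> ^ n"] \<sigma> \<sigma>n by auto
  define \<delta> where "\<delta> = min \<delta>1 \<delta>2"
  have onto: "ball z0 \<delta> \<subseteq> \<zeta> ` ball 0 \<sigma>"
  proof
    fix z assume "z \<in> ball z0 \<delta>"
    then obtain u where u: "u \<in> ball 0 (\<sigma> ^ n)" "z = \<alpha> u"
      using \<delta>1 by (auto simp: \<delta>_def)
    then obtain s where "s ^ n = u" "cmod s < \<sigma>"
      using complex_nth_root_ball[OF n(1) _ \<sigma>(1), of u] by auto
    then show "z \<in> \<zeta> ` ball 0 \<sigma>" using u by (force simp: \<zeta>_def)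
  qed
  have \<zeta>0: "\<zeta> 0 = z0" using n \<alpha>(3) by (simp add: \<zeta>_def zero_power)
  have \<zeta>ne: "\<zeta> s \<noteq> z0" if "s \<in> ball 0 \<sigma> - {0}" for s
  proof
    assume "\<zeta> s = z0"
    then have "\<alpha> (s ^ n) = \<alpha> 0" by (simp add: \<zeta>_def \<alpha>(3))
    moreover have "s ^ n \<in> ball 0 \<rho>1" using pow[of s n] that n(1) sub1 by blast
    moreover have "0 \<in> ball 0 \<rho>1" using m(2) by simp
    ultimately have "s ^ n = 0" by (rule inj_onD[OF \<alpha>(2)])
    then show False using that by simp
  qed
  have f\<zeta>: "f (\<zeta> s) = f z0 + (s ^ n) ^ m" if "s \<in> ball 0 \<sigma>" for s
  proof -
    have "s ^ n \<in> ball 0 \<rho>1" using pow[of s n] that n(1) sub1 by blast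
    then show ?thesis by (simp add: \<zeta>_def \<alpha>(4))
  qed
  have f\<beta>: "f (\<beta> \<omega> s) = f (\<zeta> s)" if "s \<in> ball 0 \<sigma>" "\<omega> ^ n = 1" for \<omega> s
    using \<gamma>(4)[OF \<omega>ball[OF that]] f\<zeta>[OF that(1)] that(2) assms(1)
    by (simp add: \<beta>_def power_mult_distrib flip: power_mult) (simp add: mult.commute)
  have d\<zeta>: "deriv \<zeta> s \<noteq> 0" if "s \<in> ball 0 \<sigma> - {0}" for s
  proof -
    have sn: "s ^ n \<in> ball 0 \<rho>1" using pow[of s n] that n(1) sub1 by blast
    then have "(\<alpha> has_field_derivative deriv \<alpha> (s ^ n)) (at (s ^ n))"
      using \<alpha>(1) by (intro holomorphic_derivI) auto
    then have "((\<alpha> \<circ> (\<lambda>s. s ^ n)) has_field_derivative deriv \<alpha> (s ^ n) * (of_nat n * s ^ (n - 1))) (at s)"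
      by (rule DERIV_chain) (auto intro!: derivative_eq_intros)
    then have "deriv \<zeta> s = deriv \<alpha> (s ^ n) * (of_nat n * s ^ (n - 1))"
      by (simp add: \<zeta>_def comp_def DERIV_imp_deriv)
    moreover have "deriv \<alpha> (s ^ n) \<noteq> 0"
      using holomorphic_injective_imp_regular[OF \<alpha>(1) open_ball \<alpha>(2) sn] .
    ultimately show ?thesis using that n(1) by simp
  qed
  have chart: "\<exists>\<beta>\<in>B. \<exists>s\<in>ball 0 \<sigma> - {0}. \<zeta> s = z \<and> \<beta> s = w \<and>
         (\<forall>s'\<in>ball 0 \<sigma> - {0}. parametrises_branch \<zeta> \<beta> s')"
    if z: "z \<in> ball z0 \<delta> - {z0}" and w: "w \<in> ball w0 \<delta>" and zw: "w \<in> branch_values \<Phi> z" for z w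
  proof -
    obtain s where s: "s \<in> ball 0 \<sigma>" "\<zeta> s = z" using z onto by blast
    then have "s \<noteq> 0" using z \<zeta>0 by auto
    obtain v where v: "v \<in> ball 0 \<rho>2" "w = \<gamma> v" using w \<delta>2 by (auto simp: \<delta>_def)
    have "f w = f z" using zw by (rule automorphic_value)
    then have vn: "v ^ n = (s ^ n) ^ m"
      using \<gamma>(4)[OF v(1)] v(2) f\<zeta>[OF s(1)] s(2) assms(1) by simp
    define \<omega> where "\<omega> = v / s ^ m"
    have \<omega>: "\<omega> ^ n = 1"
      using \<open>s \<noteq> 0\<close> vn by (simp add: \<omega>_def power_divide flip: power_mult) (simp add: mult.commute)
    have v\<omega>: "v = \<omega> * s ^ m" using \<open>s \<noteq> 0\<close> by (simp add: \<omega>_def)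
    then have \<beta>s: "\<beta> \<omega> s = w" using v(2) by (simp add: \<beta>_def)
    have "v \<noteq> 0" using vn \<open>s \<noteq> 0\<close> n by (auto simp: zero_power)
    \<comment> \<open>Off the centre of the chart \<open>f\<close> is locally injective at \<open>w\<close>, so
      \<open>f w = f z\<close> determines the branch through \<open>(z, w)\<close>.\<close>
    have "deriv f w \<noteq> 0"
    proof
      assume "deriv f w = 0"
      then have "(f has_field_derivative 0) (at (\<gamma> v))"
        using holomorphic_derivI[OF entire open_UNIV UNIV_I, of w] v(2) by simp
      moreover have "(\<gamma> has_field_derivative deriv \<gamma> v) (at v)"
        using \<gamma>(1) v(1) by (intro holomorphic_derivI) auto
      ultimately have "((f \<circ> \<gamma>) has_field_derivative 0 * deriv \<gamma> v) (at v)"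
        by (rule DERIV_chain)
      then have "((\<lambda>u. f w0 + u ^ n) has_field_derivative 0 * deriv \<gamma> v) (at v)"
        by (rule has_field_derivative_transform_within_open[OF _ open_ball v(1)]) (simp add: \<gamma>(4))
      moreover have "((\<lambda>u. f w0 + u ^ n) has_field_derivative of_nat n * v ^ (n - 1)) (at v)"
        by (auto intro!: derivative_eq_intros)
      ultimately have "of_nat n * v ^ (n - 1) = 0 * deriv \<gamma> v" by (rule DERIV_unique[rotated])
      then show False using n(1) \<open>v \<noteq> 0\<close> by simp
    qed
    then obtain e where e: "e > 0" "inj_on f (ball w e)"
      using has_complex_derivative_locally_injective[OF entire UNIV_I open_UNIV] by metis
    obtain a r \<phi> where \<phi>: "(a, r, \<phi>) \<in> \<Phi>" "z \<in> ball a r" "w = \<phi> z"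
      using zw unfolding branch_values_def by auto
    have cont\<zeta>: "isCont \<zeta> s"
      using \<zeta> s(1) by (meson continuous_on_eq_continuous_at holomorphic_on_imp_continuous_on open_ball)
    have "isCont \<phi> (\<zeta> s)"
      using element_holomorphic(2)[OF \<phi>(1)] \<phi>(2) s(2)
      by (meson continuous_on_eq_continuous_at holomorphic_on_imp_continuous_on open_ball)
    then have "isCont (\<lambda>s. \<phi> (\<zeta> s)) s"
      using cont\<zeta> isCont_o2 by blast
    then have ev1: "\<forall>\<^sub>F s' in nhds s. \<phi> (\<zeta> s') \<in> ball w e"
      by (rule isCont_eventually_in_open) (use \<phi>(3) s(2) e(1) in auto)
    have "isCont (\<beta> \<omega>) s"
      using \<beta>[OF \<omega>] s(1) by (meson continuous_on_eq_continuous_at holomorphic_on_imp_continuous_on open_ball)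
    then have ev2: "\<forall>\<^sub>F s' in nhds s. \<beta> \<omega> s' \<in> ball w e"
      by (rule isCont_eventually_in_open) (use \<beta>s e(1) in auto)
    have ev3: "\<forall>\<^sub>F s' in nhds s. \<zeta> s' \<in> ball a r"
      using cont\<zeta> by (rule isCont_eventually_in_open) (use \<phi>(2) s(2) in auto)
    have ev4: "\<forall>\<^sub>F s' in nhds s. s' \<in> ball 0 \<sigma>"
      using s(1) by (intro eventually_nhds_in_open) auto
    have "\<forall>\<^sub>F s' in nhds s. \<phi> (\<zeta> s') = \<beta> \<omega> s'"
      using ev1 ev2 ev3 ev4
    proof eventually_elim
      case (elim s')
      then have "f (\<phi> (\<zeta> s')) = f (\<beta> \<omega> s')"
        using f\<beta>[OF _ \<omega>, of s'] automorphic[OF \<phi>(1), of "\<zeta> s'"] by simp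
      then show ?case using elim by (auto intro: inj_onD[OF e(2)])
    qed
    then have at_s: "parametrises_branch \<zeta> (\<beta> \<omega>) s"
      using \<phi> s(2) unfolding parametrises_branch_def by blast
    have "parametrises_branch \<zeta> (\<beta> \<omega>) s'" if "s' \<in> ball 0 \<sigma> - {0}" for s'
    proof (rule parametrises_branch_spreads[OF _ _ _ _ _ _ at_s that])
      show "connected (ball 0 \<sigma> - {0::complex})" by (rule connected_punctured_ball) simp
      show "open (ball 0 \<sigma> - {0::complex})" by auto
      show "\<zeta> holomorphic_on ball 0 \<sigma> - {0}" using \<zeta> by (rule holomorphic_on_subset) auto
      show "\<beta> \<omega> holomorphic_on ball 0 \<sigma> - {0}" using \<beta>[OF \<omega>] by (rule holomorphic_on_subset) auto
    qed (use d\<zeta> s(1) \<open>s \<noteq> 0\<close> in auto)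
    moreover have "\<beta> \<omega> \<in> B" using \<omega> by (auto simp: B_def)
    ultimately show ?thesis using s \<open>s \<noteq> 0\<close> \<beta>s by blast
  qed
  show ?thesis
  proof (rule that[of \<sigma> \<delta> B \<zeta>])
    show "finite B" unfolding B_def using n(1) by (intro finite_imageI finite_roots_unity) auto
    show "\<zeta> ` ball 0 \<sigma> \<subseteq> U"
    proof
      fix z assume "z \<in> \<zeta> ` ball 0 \<sigma>"
      then obtain s where s: "s \<in> ball 0 \<sigma>" "z = \<zeta> s" by blast
      then have "s ^ n \<in> ball 0 \<rho>" using pow[of s n] n(1) \<sigma>(3) by fastforce
      then show "z \<in> U" using \<rho>(2) s by (auto simp: \<zeta>_def)
    qed
    show "\<exists>d>0. \<forall>s\<in>ball 0 \<sigma>. \<zeta> s \<in> ball z0 d \<longrightarrow> cmod s < e" if e: "e > 0" for e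
    proof -
      define e' where "e' = min (e ^ n) \<rho>1"
      obtain d where d: "d > 0" "ball z0 d \<subseteq> \<alpha> ` ball 0 e'"
        using image_\<alpha>[of e'] e m by (auto simp: e'_def)
      have "cmod s < e" if s: "s \<in> ball 0 \<sigma>" "\<zeta> s \<in> ball z0 d" for s
      proof -
        obtain u where u: "u \<in> ball 0 e'" "\<alpha> (s ^ n) = \<alpha> u"
          using s d by (auto simp: \<zeta>_def)
        have "s ^ n \<in> ball 0 \<rho>1" using pow[of s n] s n(1) sub1 by blast
        moreover have "u \<in> ball 0 \<rho>1" using u by (auto simp: e'_def)
        ultimately have "s ^ n = u" by (rule inj_onD[OF \<alpha>(2) u(2)])
        then have "cmod s ^ n < e ^ n" using u by (auto simp: e'_def norm_power)
        then show ?thesis using e power_less_imp_less_base by (metis less_imp_le)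
      qed
      then show ?thesis using d(1) by blast
    qed
    show "\<beta>' holomorphic_on ball 0 \<sigma>" if "\<beta>' \<in> B" for \<beta>'
      using that \<beta> by (auto simp: B_def)
  qed (use \<sigma>(1) \<delta>1(1) \<delta>2(1) \<zeta> \<zeta>ne onto \<zeta>0 chart in \<open>auto simp: \<delta>_def\<close>)
qed

end

section \<open>A maximum principle on the branches\<close>

context automorphic_branches
begin

text \<open>
Only the restriction of \<open>Q\<close> to the surface matters. At other pairs \<open>(z, w)\<close> the quotients to which
this is applied may have zero denominators.
\<close>

definition holomorphic_along_branches :: "(complex \<Rightarrow> complex \<Rightarrow> complex) \<Rightarrow> complex set \<Rightarrow> bool"
  where "holomorphic_along_branches Q U \<longleftrightarrow>
    (\<forall>(a, r, \<phi>)\<in>\<Phi>. (\<lambda>z. Q z (\<phi> z)) holomorphic_on ball a r \<inter> U)"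

lemma holomorphic_along_branchesD:
  "holomorphic_along_branches Q U \<Longrightarrow> (a, r, \<phi>) \<in> \<Phi> \<Longrightarrow> (\<lambda>z. Q z (\<phi> z)) holomorphic_on ball a r \<inter> U"
  unfolding holomorphic_along_branches_def by auto

text \<open>
A value of modulus greater than \<open>t\<close> persists at nearby base points, so any single base point \<open>x\<close>
can be avoided; below, \<open>x\<close> is a possible branch point.
\<close>

lemma branch_value_near:
  assumes Q: "holomorphic_along_branches Q U" "open U"
    and "z \<in> U" "w \<in> branch_values \<Phi> z" "cmod (Q z w) > t" "e > 0"
  obtains z' w' where "z' \<in> U" "w' \<in> branch_values \<Phi> z'" "cmod (Q z' w') > t" "dist z z' < e" "z' \<noteq> x"
proof -
  obtain a r \<phi> where \<phi>: "(a, r, \<phi>) \<in> \<Phi>" "z \<in> ball a r" "w = \<phi> z"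
    using assms(4) unfolding branch_values_def by auto
  have op: "open (ball a r \<inter> U)" using Q(2) by auto
  have "continuous_on (ball a r \<inter> U) (\<lambda>z. cmod (Q z (\<phi> z)))"
    using holomorphic_along_branchesD[OF Q(1) \<phi>(1)]
    by (intro continuous_on_norm holomorphic_on_imp_continuous_on)
  then have "open ((ball a r \<inter> U) \<inter> (\<lambda>z. cmod (Q z (\<phi> z))) -` {t<..})"
    using op by (intro continuous_open_preimage) auto
  then have "open ((ball a r \<inter> U) \<inter> (\<lambda>z. cmod (Q z (\<phi> z))) -` {t<..} \<inter> ball z e)"
    by auto
  moreover have "z \<in> (ball a r \<inter> U) \<inter> (\<lambda>z. cmod (Q z (\<phi> z))) -` {t<..} \<inter> ball z e"
    using assms \<phi> by simp
  ultimately obtain d where d: "d > 0"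
    "ball z d \<subseteq> (ball a r \<inter> U) \<inter> (\<lambda>z. cmod (Q z (\<phi> z))) -` {t<..} \<inter> ball z e"
    using openE by blast
  define z' where "z' = (if x = z then z + of_real (d / 2) else z)"
  have z': "z' \<in> ball z d" "z' \<noteq> x"
    using d(1) by (auto simp: z'_def dist_norm)
  then have "\<phi> z' \<in> branch_values \<Phi> z'"
    using d(2) by (intro branch_valuesI[OF \<phi>(1)]) auto
  then show ?thesis
    using z' d(2) by (intro that[of z' "\<phi> z'"]) auto
qed

text \<open>
Let \<open>S\<close> be the supremum of \<open>cmod Q\<close> on the surface and \<open>A\<close> the set of base points to which
points of the surface with values of modulus close to \<open>S\<close> converge. If \<open>S > M\<close>, then \<open>A\<close> is a
nonempty closed set inside \<open>cball c R'\<close>. It is also open: along a sequence converging to a point of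
\<open>A\<close> the values \<open>w\<close> stay bounded, because \<open>Q\<close> is small where \<open>w\<close> is large, and so they accumulate
at a finite \<open>w0\<close>; in one of the charts at \<open>(z0, w0)\<close> the function \<open>Q\<close> extends over \<open>s = 0\<close> and
attains its maximal modulus \<open>S\<close> there, hence it is constant and all base points of the chart belong
to \<open>A\<close>. But the connected plane has no bounded nonempty open and closed subset.
\<close>

lemma branch_maximum_principle:
  assumes hol: "holomorphic_along_branches Q (ball c R - {c})"
    and bdd: "\<And>z w. z \<in> ball c R - {c} \<Longrightarrow> w \<in> branch_values \<Phi> z \<Longrightarrow> cmod (Q z w) \<le> K"
    and infinity: "\<And>e. e > 0 \<Longrightarrow>
      \<exists>L. \<forall>z\<in>ball c R - {c}. \<forall>w\<in>branch_values \<Phi> z. cmod (Q z w) \<ge> e \<longrightarrow> cmod w \<le> L"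
    and R': "R' < R" and outer: "\<And>z w. z \<in> ball c R - {c} \<Longrightarrow> dist c z \<ge> R' \<Longrightarrow>
      w \<in> branch_values \<Phi> z \<Longrightarrow> cmod (Q z w) \<le> M"
    and M: "0 \<le> M"
    and zw: "z \<in> ball c R - {c}" "w \<in> branch_values \<Phi> z"
  shows "cmod (Q z w) \<le> M"
proof (rule ccontr)
  assume gt: "\<not> cmod (Q z w) \<le> M"
  define D where "D = ball c R - {c}"
  have D: "open D" by (auto simp: D_def)
  define X where "X = {cmod (Q z w) | z w. z \<in> D \<and> w \<in> branch_values \<Phi> z}"
  define S where "S = Sup X"
  have X: "bdd_above X" "cmod (Q z w) \<in> X"
    using bdd zw by (auto simp: X_def D_def intro!: bdd_aboveI[of _ K])
  have SM: "M < S"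
    using cSup_upper[OF X(2,1)] gt by (simp add: S_def)
  have le_S: "cmod (Q z w) \<le> S" if "z \<in> D" "w \<in> branch_values \<Phi> z" for z w
    using that X(1) unfolding S_def by (intro cSup_upper) (auto simp: X_def)
  have near_S: "\<exists>z\<in>D. \<exists>w\<in>branch_values \<Phi> z. cmod (Q z w) > t" if "t < S" for t
    using less_cSup_iff[of X t] X that by (auto simp: X_def S_def)
  define A where "A = {z. \<forall>e>0. \<exists>z'\<in>D. \<exists>w\<in>branch_values \<Phi> z'. dist z z' < e \<and> cmod (Q z' w) > S - e}"
  have inner: "z \<in> cball c R'" if z: "z \<in> D" "w \<in> branch_values \<Phi> z" "cmod (Q z w) > M" for z w
    using outer[of z w] that by (force simp: D_def)
  have A_sub: "A \<subseteq> cball c R'"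
  proof
    fix z assume z: "z \<in> A"
    have "z \<in> closure (cball c R')"
      unfolding closure_approachable
    proof (intro allI impI)
      fix e :: real assume "e > 0"
      then have "min e (S - M) > 0" using SM by simp
      then obtain z' w where "z' \<in> D" "w \<in> branch_values \<Phi> z'" "dist z z' < min e (S - M)"
        "cmod (Q z' w) > S - min e (S - M)"
        using z unfolding A_def by blast
      then show "\<exists>y\<in>cball c R'. dist y z < e"
        using inner[of z' w] by (intro bexI[of _ z']) (auto simp: dist_commute)
    qed
    then show "z \<in> cball c R'" by simp
  qed
  have "closed A"
  proof -
    have "z \<in> A" if z: "z \<in> closure A" for z
      unfolding A_def
    proof (intro CollectI allI impI)
      fix e :: real assume "e > 0"
      then obtain a where a: "a \<in> A" "dist a z < e / 2"
        using z unfolding closure_approachable by (meson half_gt_zero)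
      moreover obtain z' w where "z' \<in> D" "w \<in> branch_values \<Phi> z'" "dist a z' < e / 2" "cmod (Q z' w) > S - e / 2"
        using a(1) \<open>e > 0\<close> unfolding A_def by (auto dest!: spec[of _ "e / 2"])
      ultimately show "\<exists>z'\<in>D. \<exists>w\<in>branch_values \<Phi> z'. dist z z' < e \<and> cmod (Q z' w) > S - e"
        using dist_triangle[of z z' a] \<open>e > 0\<close>
        by (intro bexI[of _ z'] bexI[of _ w]) (auto simp: dist_commute)
    qed
    then show ?thesis using closure_subset_eq by blast
  qed
  moreover have "A \<noteq> {}"
  proof -
    have "\<forall>n. \<exists>z w. z \<in> D \<and> w \<in> branch_values \<Phi> z \<and> cmod (Q z w) > max M (S - 1 / Suc n)"
    proof
      fix n
      have "max M (S - 1 / Suc n) < S" using SM by simp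
      then show "\<exists>z w. z \<in> D \<and> w \<in> branch_values \<Phi> z \<and> cmod (Q z w) > max M (S - 1 / Suc n)"
        using near_S by blast
    qed
    then obtain Z W where ZW: "\<And>n. Z n \<in> D" "\<And>n. W n \<in> branch_values \<Phi> (Z n)"
      "\<And>n. cmod (Q (Z n) (W n)) > max M (S - 1 / Suc n)" by metis
    have "\<forall>n. Z n \<in> cball c R'" using inner ZW by (metis max_less_iff_conj)
    then obtain l k where l: "strict_mono k" "(Z \<circ> k) \<longlonglongrightarrow> l"
      using compact_cball[of c R'] unfolding compact_def by metis
    have "l \<in> A"
      unfolding A_def
    proof (intro CollectI allI impI)
      fix e :: real assume e: "e > 0"
      have "\<forall>\<^sub>F n in sequentially. dist ((Z \<circ> k) n) l < e"
        using l(2) e by (rule tendstoD)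
      moreover have "\<forall>\<^sub>F n in sequentially. 1 / real (Suc n) < e"
        using order_tendstoD(2)[OF LIMSEQ_inverse_real_of_nat e] by (simp add: inverse_eq_divide)
      ultimately have "\<forall>\<^sub>F n in sequentially. dist ((Z \<circ> k) n) l < e \<and> 1 / real (Suc n) < e"
        by (rule eventually_conj)
      then obtain n where n: "dist (Z (k n)) l < e" "1 / real (Suc n) < e"
        by (auto dest: eventually_happens)
      have "1 / real (Suc (k n)) \<le> 1 / real (Suc n)"
        using seq_suble[OF l(1), of n] by (intro divide_left_mono) auto
      then have "S - e < cmod (Q (Z (k n)) (W (k n)))"
        using n(2) ZW(3)[of "k n"] by simp
      then show "\<exists>z'\<in>D. \<exists>w\<in>branch_values \<Phi> z'. dist l z' < e \<and> cmod (Q z' w) > S - e"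
        using ZW(1,2)[of "k n"] n(1) by (intro bexI[of _ "Z (k n)"] bexI[of _ "W (k n)"]) (auto simp: dist_commute)
    qed
    then show ?thesis by blast
  qed
  moreover have "open A"
    unfolding open_contains_ball
  proof
    fix z0 assume z0: "z0 \<in> A"
    \<comment> \<open>The bound \<open>t > 0\<close> below \<open>S\<close> keeps \<open>Q\<close> away from
      \<open>0\<close>, hence \<open>w\<close> bounded, along the sequence.\<close>
    define t where "t = (S + M) / 2"
    have t: "0 < t" "t < S" using SM M by (auto simp: t_def)
    have "\<forall>n. \<exists>z w. z \<in> D \<and> w \<in> branch_values \<Phi> z \<and> dist z0 z < 1 / Suc n \<and> z \<noteq> z0 \<and>
        cmod (Q z w) > t \<and> cmod (Q z w) > S - 1 / Suc n"
    proof
      fix n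
      define h where "h = 1 / real (Suc n)"
      define e where "e = min (S - t) (h / 2)"
      have e: "e > 0" "e \<le> h / 2" "e \<le> S - t"
        using t by (auto simp: e_def h_def)
      then obtain z w where "z \<in> D" "w \<in> branch_values \<Phi> z" "dist z0 z < e" "cmod (Q z w) > S - e"
        using z0 unfolding A_def by blast
      then obtain z' w' where *: "z' \<in> D" "w' \<in> branch_values \<Phi> z'" "cmod (Q z' w') > S - e"
         "dist z z' < e" "z' \<noteq> z0"
        using branch_value_near[OF hol[folded D_def] D, of z w "S - e" e z0] e(1) by blast
      moreover have "dist z0 z' < h"
        using dist_triangle[of z0 z' z] * \<open>dist z0 z < e\<close> e(2) by linarith
      moreover have "S - e \<ge> t" "S - e \<ge> S - h"
        using e by linarith+
      ultimately show "\<exists>z w. z \<in> D \<and> w \<in> branch_values \<Phi> z \<and> dist z0 z < 1 / Suc n \<and> z \<noteq> z0 \<and>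
        cmod (Q z w) > t \<and> cmod (Q z w) > S - 1 / Suc n"
        unfolding h_def by (intro exI[of _ z'] exI[of _ w']) auto
    qed
    then obtain Z W where ZW: "\<And>n. Z n \<in> D" "\<And>n. W n \<in> branch_values \<Phi> (Z n)"
      "\<And>n. dist z0 (Z n) < 1 / Suc n" "\<And>n. Z n \<noteq> z0"
      "\<And>n. cmod (Q (Z n) (W n)) > t" "\<And>n. cmod (Q (Z n) (W n)) > S - 1 / Suc n" by metis
    have inv: "(\<lambda>n. 1 / real (Suc n)) \<longlonglongrightarrow> 0"
      using LIMSEQ_inverse_real_of_nat by (simp add: inverse_eq_divide)
    have Zlim: "Z \<longlonglongrightarrow> z0"
      unfolding tendsto_dist_iff[of Z]
    proof (rule Lim_null_comparison[OF _ inv])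
      show "\<forall>\<^sub>F n in sequentially. norm (dist (Z n) z0) \<le> 1 / real (Suc n)"
        using ZW(3) by (auto simp: dist_commute less_imp_le intro!: always_eventually)
    qed
    obtain L where L: "\<forall>z\<in>D. \<forall>w\<in>branch_values \<Phi> z. cmod (Q z w) \<ge> t \<longrightarrow> cmod w \<le> L"
      using infinity[OF t(1)] by (auto simp: D_def)
    have "\<forall>n. W n \<in> cball 0 L"
    proof
      fix n
      show "W n \<in> cball 0 L"
        using bspec[OF bspec[OF L ZW(1)] ZW(2)[of n]] ZW(5)[of n] by simp
    qed
    then obtain w0 k where k: "strict_mono k" "(W \<circ> k) \<longlonglongrightarrow> w0"
      using compact_cball[of "0::complex" L] unfolding compact_def by metis
    have Zk: "(Z \<circ> k) \<longlonglongrightarrow> z0"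
      using Zlim k(1) by (rule LIMSEQ_subseq_LIMSEQ)
    have invk: "((\<lambda>n. 1 / real (Suc n)) \<circ> k) \<longlonglongrightarrow> 0"
      using inv k(1) by (rule LIMSEQ_subseq_LIMSEQ)
    have contf: "isCont f x" for x
      using entire by (meson continuous_on_eq_continuous_at holomorphic_on_imp_continuous_on open_UNIV UNIV_I)
    have "(\<lambda>n. f ((W \<circ> k) n)) \<longlonglongrightarrow> f w0" "(\<lambda>n. f ((Z \<circ> k) n)) \<longlonglongrightarrow> f z0"
      by (rule isCont_tendsto_compose[OF contf k(2)], rule isCont_tendsto_compose[OF contf Zk])
    moreover have "f ((W \<circ> k) n) = f ((Z \<circ> k) n)" for n
      using automorphic_value ZW(2) by simp
    ultimately have fw0: "f w0 = f z0"
      by (simp add: LIMSEQ_unique)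
    \<comment> \<open>\<open>Q\<close> is controlled off \<open>c\<close> only. If \<open>z0 = c\<close> the chart
      meets \<open>c\<close> in \<open>s = 0\<close> alone; otherwise \<open>c\<close> is cut out.\<close>
    define U where "U = ball c R - ({c} - {z0})"
    have U: "open U" "z0 \<in> U"
      using z0 A_sub R' by (auto simp: U_def intro!: open_Diff finite_imp_closed)
    obtain \<sigma> \<delta> \<zeta> B where \<sigma>: "0 < \<sigma>" and \<delta>: "0 < \<delta>" and B: "finite B" and \<zeta>: "\<zeta> holomorphic_on ball 0 \<sigma>"
      "\<zeta> ` ball 0 \<sigma> \<subseteq> U" "\<And>s. s \<in> ball 0 \<sigma> - {0} \<Longrightarrow> \<zeta> s \<noteq> z0" "ball z0 \<delta> \<subseteq> \<zeta> ` ball 0 \<sigma>"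
      "\<zeta> 0 = z0"
      and small: "\<And>e. e > 0 \<Longrightarrow> \<exists>d>0. \<forall>s\<in>ball 0 \<sigma>. \<zeta> s \<in> ball z0 d \<longrightarrow> cmod s < e"
      and hol\<beta>: "\<And>\<beta>. \<beta> \<in> B \<Longrightarrow> \<beta> holomorphic_on ball 0 \<sigma>"
      and chart: "\<And>z w. z \<in> ball z0 \<delta> - {z0} \<Longrightarrow> w \<in> ball w0 \<delta> \<Longrightarrow> w \<in> branch_values \<Phi> z \<Longrightarrow>
         \<exists>\<beta>\<in>B. \<exists>s\<in>ball 0 \<sigma> - {0}. \<zeta> s = z \<and> \<beta> s = w \<and>
           (\<forall>s'\<in>ball 0 \<sigma> - {0}. parametrises_branch \<zeta> \<beta> s')"
      by (rule ramified_branch_chart[OF fw0 U]) (rule that)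
    have \<zeta>D: "\<zeta> s \<in> D" if "s \<in> ball 0 \<sigma> - {0}" for s
      using \<zeta>(2) \<zeta>(3)[OF that] that by (auto simp: U_def D_def image_subset_iff)
    \<comment> \<open>There are finitely many charts, so values close to \<open>S\<close> accumulate at the centre
      of one of them.\<close>
    have "\<exists>\<beta>\<in>B. (\<forall>s\<in>ball 0 \<sigma> - {0}. parametrises_branch \<zeta> \<beta> s) \<and>
      (\<forall>e>0. \<exists>s\<in>ball 0 \<sigma> - {0}. cmod s < e \<and> cmod (Q (\<zeta> s) (\<beta> s)) > S - e)"
    proof (rule ccontr)
      assume neg: "\<not> ?thesis"
      have "\<forall>\<beta>\<in>B. \<exists>e>0. (\<forall>s\<in>ball 0 \<sigma> - {0}. parametrises_branch \<zeta> \<beta> s) \<longrightarrow>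
        (\<forall>s\<in>ball 0 \<sigma> - {0}. cmod s < e \<longrightarrow> cmod (Q (\<zeta> s) (\<beta> s)) \<le> S - e)"
      proof
        fix \<beta> assume \<beta>: "\<beta> \<in> B"
        show "\<exists>e>0. (\<forall>s\<in>ball 0 \<sigma> - {0}. parametrises_branch \<zeta> \<beta> s) \<longrightarrow>
          (\<forall>s\<in>ball 0 \<sigma> - {0}. cmod s < e \<longrightarrow> cmod (Q (\<zeta> s) (\<beta> s)) \<le> S - e)"
        proof (cases "\<forall>s\<in>ball 0 \<sigma> - {0}. parametrises_branch \<zeta> \<beta> s")
          case True
          then obtain e where "e > 0" "\<not> (\<exists>s\<in>ball 0 \<sigma> - {0}. cmod s < e \<and> cmod (Q (\<zeta> s) (\<beta> s)) > S - e)"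
            using neg \<beta> by blast
          then show ?thesis by (intro exI[of _ e]) (meson not_le)
        next
          case False
          then show ?thesis by (intro exI[of _ 1]) auto
        qed
      qed
      then obtain e where e: "\<And>\<beta>. \<beta> \<in> B \<Longrightarrow> e \<beta> > 0" 
        "\<And>\<beta> s. \<beta> \<in> B \<Longrightarrow> (\<forall>s\<in>ball 0 \<sigma> - {0}. parametrises_branch \<zeta> \<beta> s) \<Longrightarrow>
          s \<in> ball 0 \<sigma> - {0} \<Longrightarrow> cmod s < e \<beta> \<Longrightarrow> cmod (Q (\<zeta> s) (\<beta> s)) \<le> S - e \<beta>"
        by metis
      define e0 where "e0 = Min (insert 1 (e ` B))"
      have e0: "e0 > 0" "\<And>\<beta>. \<beta> \<in> B \<Longrightarrow> e0 \<le> e \<beta>"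
        using B e(1) by (auto simp: e0_def)
      obtain d where d: "d > 0" "\<And>s. s \<in> ball 0 \<sigma> \<Longrightarrow> \<zeta> s \<in> ball z0 d \<Longrightarrow> cmod s < e0"
        using small[OF e0(1)] by blast
      have ev1: "\<forall>\<^sub>F n in sequentially. dist ((Z \<circ> k) n) z0 < min d \<delta>"
        by (rule tendstoD[OF Zk]) (use d(1) \<delta> in auto)
      have ev2: "\<forall>\<^sub>F n in sequentially. dist ((W \<circ> k) n) w0 < \<delta>"
        using k(2) \<delta> by (rule tendstoD)
      have ev3: "\<forall>\<^sub>F n in sequentially. ((\<lambda>n. 1 / real (Suc n)) \<circ> k) n < e0"
        using invk e0(1) by (rule order_tendstoD)
      have "\<forall>\<^sub>F n in sequentially. False"
        using ev1 ev2 ev3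
      proof eventually_elim
        case (elim n)
        then have "Z (k n) \<in> ball z0 \<delta> - {z0}" "W (k n) \<in> ball w0 \<delta>"
          using ZW(4) by (auto simp: dist_commute)
        then obtain \<beta> s where \<beta>: "\<beta> \<in> B" "s \<in> ball 0 \<sigma> - {0}" "\<zeta> s = Z (k n)" "\<beta> s = W (k n)"
          "\<forall>s'\<in>ball 0 \<sigma> - {0}. parametrises_branch \<zeta> \<beta> s'"
          using chart ZW(2) by blast
        then have "cmod s < e0" using elim by (intro d(2)) (auto simp: dist_commute)
        then have "cmod (Q (Z (k n)) (W (k n))) \<le> S - e \<beta>"
          using e(2)[OF \<beta>(1,5,2)] e0(2)[OF \<beta>(1)] \<beta>(3,4) by simp
        then show ?case using e0(2)[OF \<beta>(1)] ZW(6)[of "k n"] elim by simp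
      qed
      then show False by simp
    qed
    then obtain \<beta> where par: "\<And>s. s \<in> ball 0 \<sigma> - {0} \<Longrightarrow> parametrises_branch \<zeta> \<beta> s"
      and large: "\<And>e. e > 0 \<Longrightarrow> \<exists>s\<in>ball 0 \<sigma> - {0}. cmod s < e \<and> cmod (Q (\<zeta> s) (\<beta> s)) > S - e"
      by blast
    define q where "q = (\<lambda>s. Q (\<zeta> s) (\<beta> s))"
    have qS: "cmod (q s) \<le> S" if "s \<in> ball 0 \<sigma> - {0}" for s
      unfolding q_def using \<zeta>D[OF that] parametrises_branch_value[OF par[OF that]] by (rule le_S)
    have "q holomorphic_on ball 0 \<sigma> - {0}"
      unfolding holomorphic_on_def
    proof
      fix s :: complex assume s: "s \<in> ball 0 \<sigma> - {0}"
      obtain a r \<phi> where \<phi>: "(a, r, \<phi>) \<in> \<Phi>" "\<zeta> s \<in> ball a r" "\<forall>\<^sub>F s' in nhds s. \<phi> (\<zeta> s') = \<beta> s'"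
        using par[OF s] unfolding parametrises_branch_def by auto
      have "(\<lambda>z. Q z (\<phi> z)) field_differentiable at (\<zeta> s)"
        using holomorphic_along_branchesD[OF hol \<phi>(1)] D \<phi>(2) \<zeta>D[OF s]
        by (intro holomorphic_on_imp_differentiable_at[of _ "ball a r \<inter> D"]) (auto simp: D_def)
      moreover have "\<zeta> field_differentiable at s"
        using \<zeta>(1) s by (intro holomorphic_on_imp_differentiable_at[of _ "ball 0 \<sigma>"]) auto
      ultimately have "((\<lambda>z. Q z (\<phi> z)) \<circ> \<zeta>) field_differentiable at s"
        by (intro field_differentiable_compose)
      moreover have "\<forall>\<^sub>F s' in nhds s. ((\<lambda>z. Q z (\<phi> z)) \<circ> \<zeta>) s' = q s'"
        using \<phi>(3) by eventually_elim (simp add: q_def)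
      ultimately have "q field_differentiable at s"
        unfolding field_differentiable_def using DERIV_cong_ev by blast
      then show "q field_differentiable at s within ball 0 \<sigma> - {0}"
        by (rule field_differentiable_at_within)
    qed
    moreover have "\<forall>\<^sub>F s in at 0. cmod (q s) \<le> S"
      using \<sigma> qS unfolding eventually_at by (intro exI[of _ \<sigma>]) (auto simp: dist_norm)
    ultimately obtain g where g: "g holomorphic_on ball 0 \<sigma>" "\<And>s. s \<in> ball 0 \<sigma> - {0} \<Longrightarrow> g s = q s"
      using holomorphic_on_extend_bounded[of q "ball 0 \<sigma>" 0] \<sigma> by auto
    have g0: "S \<le> cmod (g 0)"
    proof (rule ccontr)
      assume "\<not> S \<le> cmod (g 0)"
      define x where "x = (S - cmod (g 0)) / 2"
      have x: "x > 0" "S = cmod (g 0) + 2 * x"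
        using \<open>\<not> S \<le> cmod (g 0)\<close> by (simp_all add: x_def field_simps)
      have "isCont g 0"
        using g(1) \<sigma> by (meson centre_in_ball continuous_on_eq_continuous_at holomorphic_on_imp_continuous_on open_ball)
      then obtain d where d: "d > 0" "\<And>s. dist s 0 < d \<Longrightarrow> dist (g s) (g 0) < x"
        using x(1) unfolding continuous_at_eps_delta by (metis dist_commute)
      obtain s where s: "s \<in> ball 0 \<sigma> - {0}" "cmod s < min d x" "cmod (q s) > S - min d x"
        using large[of "min d x"] d(1) x(1) unfolding q_def by (metis min_less_iff_conj)
      have "cmod (g s) \<le> cmod (g 0) + dist (g s) (g 0)"
        by (metis dist_norm add.commute diff_add_cancel norm_triangle_ineq)
      moreover have "dist (g s) (g 0) < x" using d(2)[of s] s(2) by simp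
      moreover have "S < cmod (g s) + x"
        using s(3) min.cobounded2[of d x] unfolding g(2)[OF s(1)] by linarith
      ultimately show False using x(2) by linarith
    qed
    have "g constant_on ball 0 \<sigma>"
    proof (rule maximum_modulus_principle[OF g(1) open_ball _ open_ball order_refl])
      show "cmod (g s) \<le> cmod (g 0)" if "s \<in> ball 0 \<sigma>" for s
        using that qS[of s] g(2)[of s] g0 by (cases "s = 0") auto
    qed (use \<sigma> in auto)
    then have const: "g s = g 0" if "s \<in> ball 0 \<sigma>" for s
      using that \<sigma> unfolding constant_on_def by auto
    have "ball z0 \<delta> \<subseteq> A"
    proof
      fix y assume y: "y \<in> ball z0 \<delta>"
      obtain s where s: "s \<in> ball 0 \<sigma>" "y = \<zeta> s" using y \<zeta>(4) by blast
      show "y \<in> A"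
      proof (cases "s = 0")
        case True
        then show ?thesis using s \<zeta>(5) z0 by simp
      next
        case False
        then have s': "s \<in> ball 0 \<sigma> - {0}" using s by simp
        then have "y \<in> D" "\<beta> s \<in> branch_values \<Phi> y"
          using \<zeta>D parametrises_branch_value[OF par] s(2) by auto
        moreover have "cmod (Q y (\<beta> s)) \<ge> S"
          using g(2)[OF s'] const[OF s(1)] g0 s(2) by (simp add: q_def)
        ultimately show ?thesis unfolding A_def by force
      qed
    qed
    then show "\<exists>e>0. ball z0 e \<subseteq> A" using \<delta> by blast
  qed
  ultimately have "A = UNIV" using clopen by blast
  then show False using A_sub bounded_subset[OF bounded_cball, of A] by simp
qed

end

section \<open>Automorphisms of the disc and bounded interpolation\<close>

definition disc_automorphism :: "complex \<Rightarrow> complex \<Rightarrow> complex"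
  where "disc_automorphism \<gamma> x = (x - \<gamma>) / (1 - cnj \<gamma> * x)"

lemma disc_automorphism_denom:
  assumes "cmod \<gamma> < 1" "cmod x \<le> 1"
  shows "1 - cmod \<gamma> \<le> cmod (1 - cnj \<gamma> * x)" "1 - cnj \<gamma> * x \<noteq> 0"
proof -
  have "cmod (cnj \<gamma> * x) \<le> cmod \<gamma>"
    using assms mult_left_mono[of "cmod x" 1 "cmod \<gamma>"] by (simp add: norm_mult)
  then show *: "1 - cmod \<gamma> \<le> cmod (1 - cnj \<gamma> * x)"
    using norm_triangle_ineq2[of 1 "cnj \<gamma> * x"] by simp
  then show "1 - cnj \<gamma> * x \<noteq> 0" using assms(1) by auto
qed

lemma cmod_disc_automorphism_le:
  assumes "cmod \<gamma> < 1" "cmod x \<le> 1"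
  shows "cmod (disc_automorphism \<gamma> x) \<le> 1"
proof -
  have "(cmod (1 - cnj \<gamma> * x))\<^sup>2 - (cmod (x - \<gamma>))\<^sup>2 = (1 - (cmod \<gamma>)\<^sup>2) * (1 - (cmod x)\<^sup>2)"
    by (simp add: cmod_power2) (simp add: power2_eq_square algebra_simps)
  moreover have "(1 - (cmod \<gamma>)\<^sup>2) * (1 - (cmod x)\<^sup>2) \<ge> 0"
    using assms by (intro mult_nonneg_nonneg) (auto simp: power_le_one)
  ultimately have "(cmod (x - \<gamma>))\<^sup>2 \<le> (cmod (1 - cnj \<gamma> * x))\<^sup>2" by linarith
  then have "cmod (x - \<gamma>) \<le> cmod (1 - cnj \<gamma> * x)" by (rule power2_le_imp_le) simp
  then show ?thesis
    using disc_automorphism_denom[OF assms] by (simp add: disc_automorphism_def norm_divide)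
qed

lemma disc_automorphism_inverse:
  assumes "cmod \<gamma> < 1" "cmod x \<le> 1"
  shows "disc_automorphism (- \<gamma>) (disc_automorphism \<gamma> x) = x"
proof -
  have ne: "1 - cnj \<gamma> * x \<noteq> 0" by (rule disc_automorphism_denom[OF assms])
  have "\<gamma> * cnj \<gamma> \<noteq> 1"
    using assms(1) by (metis complex_norm_square norm_of_real norm_power of_real_eq_1_iff power_one
        norm_one abs_norm_cancel abs_square_eq_1 less_irrefl of_real_power)
  define D where "D = 1 - cnj \<gamma> * x"
  have 1: "disc_automorphism \<gamma> x + \<gamma> = x * (1 - \<gamma> * cnj \<gamma>) / D"
    using ne unfolding disc_automorphism_def D_def by (simp add: field_simps)
  have 2: "1 + cnj \<gamma> * disc_automorphism \<gamma> x = (1 - \<gamma> * cnj \<gamma>) / D"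
    using ne unfolding disc_automorphism_def D_def by (simp add: field_simps)
  have "D \<noteq> 0" using ne by (simp add: D_def)
  then have "x * (1 - \<gamma> * cnj \<gamma>) / D / ((1 - \<gamma> * cnj \<gamma>) / D) = x"
    using \<open>\<gamma> * cnj \<gamma> \<noteq> 1\<close> by simp
  then show ?thesis
    using 1 2 by (simp add: disc_automorphism_def[of "- \<gamma>"])
qed

lemma disc_automorphism_lipschitz:
  assumes "cmod \<gamma> < 1" "cmod x \<le> 1" "cmod y \<le> 1"
  shows "cmod (disc_automorphism \<gamma> x - disc_automorphism \<gamma> y) \<le> cmod (x - y) / (1 - cmod \<gamma>)\<^sup>2"
proof -
  note ne = disc_automorphism_denom[OF assms(1,2)] disc_automorphism_denom[OF assms(1,3)]
  have "disc_automorphism \<gamma> x - disc_automorphism \<gamma> y =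
      (x - y) * (1 - \<gamma> * cnj \<gamma>) / ((1 - cnj \<gamma> * x) * (1 - cnj \<gamma> * y))"
    using ne(2,4) unfolding disc_automorphism_def by (simp add: field_simps)
  then have "cmod (disc_automorphism \<gamma> x - disc_automorphism \<gamma> y) =
      cmod (x - y) * cmod (1 - \<gamma> * cnj \<gamma>) / (cmod (1 - cnj \<gamma> * x) * cmod (1 - cnj \<gamma> * y))"
    by (simp add: norm_mult norm_divide)
  also have "\<dots> \<le> cmod (x - y) * 1 / ((1 - cmod \<gamma>) * (1 - cmod \<gamma>))"
  proof (intro frac_le mult_mono)
    have "1 - \<gamma> * cnj \<gamma> = of_real (1 - (cmod \<gamma>)\<^sup>2)"
      by (metis complex_norm_square of_real_1 of_real_diff)
    then have "cmod (1 - \<gamma> * cnj \<gamma>) = \<bar>1 - (cmod \<gamma>)\<^sup>2\<bar>" by (metis norm_of_real)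
    also have "\<dots> \<le> 1" using assms(1) by (simp add: power_le_one abs_le_iff)
    finally show "cmod (1 - \<gamma> * cnj \<gamma>) \<le> 1" .
  qed (use ne assms(1) in auto)
  finally show ?thesis by (simp add: power2_eq_square)
qed

lemma disc_automorphism_holomorphic:
  assumes "cmod \<gamma> < 1" "g holomorphic_on S" "\<And>z. z \<in> S \<Longrightarrow> cmod (g z) \<le> 1"
  shows "(\<lambda>z. disc_automorphism \<gamma> (g z)) holomorphic_on S"
  unfolding disc_automorphism_def
  using disc_automorphism_denom(2)[OF assms(1,3)] by (intro holomorphic_intros assms(2)) auto

lemma holomorphic_zero_quotient_bounded:
  assumes "k holomorphic_on ball c \<delta>" "0 < \<delta>" "k c = 0"
  obtains d L where "0 < d" "\<And>z. z \<noteq> c \<Longrightarrow> dist c z < d \<Longrightarrow> cmod (k z / (z - c)) \<le> L"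
proof -
  have "(k has_field_derivative deriv k c) (at c)"
    using assms by (intro holomorphic_derivI) auto
  then have "((\<lambda>z. k z / (z - c)) \<longlongrightarrow> deriv k c) (at c)"
    by (simp add: has_field_derivative_iff assms(3))
  then have "((\<lambda>z. cmod (k z / (z - c))) \<longlongrightarrow> cmod (deriv k c)) (at c)"
    by (rule tendsto_norm)
  then have "\<forall>\<^sub>F z in at c. cmod (k z / (z - c)) < cmod (deriv k c) + 1"
    by (rule order_tendstoD) simp
  then obtain d where "0 < d" "\<And>z. z \<noteq> c \<Longrightarrow> dist z c < d \<Longrightarrow> cmod (k z / (z - c)) < cmod (deriv k c) + 1"
    unfolding eventually_at by auto
  then show ?thesis
    by (intro that[of d "cmod (deriv k c) + 1"]) (auto simp: dist_commute less_imp_le)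
qed

text \<open>
Agreement of order \<open>N > k\<close> with a function bounded by \<open>1\<close> on \<open>ball c R\<close> gives the Taylor
coefficient of \<open>h\<close> of order \<open>k\<close> the bound that the inequalities of Cauchy yield for such a
function, although \<open>h\<close> itself is given on a smaller disc only.
\<close>

lemma bounded_interpolants_imp_extension:
  assumes h: "h holomorphic_on ball c \<delta>" and \<delta>: "0 < \<delta>" "\<delta> \<le> R"
    and T: "\<And>N. \<exists>T C. T holomorphic_on ball c R \<and> (\<forall>z\<in>ball c R. cmod (T z) \<le> 1) \<and>
      (\<forall>\<^sub>F z in at c. cmod (h z - T z) \<le> C * cmod (z - c) ^ N)"
  obtains H where "H holomorphic_on ball c R" "\<And>z. z \<in> ball c \<delta> \<Longrightarrow> H z = h z"
proof -
  have coeff: "cmod ((deriv ^^ k) h c) \<le> fact k / \<rho> ^ k" if \<rho>: "0 < \<rho>" "\<rho> < R" for k \<rho>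
  proof -
    \<comment> \<open>Order \<open>k + 1\<close> is what makes the Cauchy bound for \<open>h - T\<close> on a
      circle of radius \<open>x\<close> tend to \<open>0\<close> with \<open>x\<close>.\<close>
    obtain T C where T: "T holomorphic_on ball c R" "\<And>z. z \<in> ball c R \<Longrightarrow> cmod (T z) \<le> 1"
      and ev: "\<forall>\<^sub>F z in at c. cmod (h z - T z) \<le> C * cmod (z - c) ^ (Suc k)"
      using T[of "Suc k"] by blast
    obtain d where d: "d > 0" "\<And>z. z \<noteq> c \<Longrightarrow> dist z c < d \<Longrightarrow> cmod (h z - T z) \<le> C * cmod (z - c) ^ (Suc k)"
      using ev unfolding eventually_at by auto
    have T\<delta>: "T holomorphic_on ball c \<delta>"
      using T(1) subset_ball[OF \<delta>(2)] by (rule holomorphic_on_subset)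
    have hT: "(\<lambda>z. h z - T z) holomorphic_on ball c \<delta>"
      using h T\<delta> by (intro holomorphic_intros)
    have "cmod ((deriv ^^ k) (\<lambda>z. h z - T z) c) \<le> fact k * C * x" if x: "0 < x" "x < min d \<delta>" for x
    proof -
      have sub: "cball c x \<subseteq> ball c \<delta>" using x by auto
      have "cmod ((deriv ^^ k) (\<lambda>z. h z - T z) c) \<le> fact k * (C * x ^ Suc k) / x ^ k"
      proof (rule Cauchy_inequality)
        show "(\<lambda>z. h z - T z) holomorphic_on ball c x"
          using hT by (rule holomorphic_on_subset) (use x in auto)
        show "continuous_on (cball c x) (\<lambda>z. h z - T z)"
          using hT sub by (meson continuous_on_subset holomorphic_on_imp_continuous_on)
        fix z assume z: "cmod (c - z) = x"
        then show "cmod (h z - T z) \<le> C * x ^ Suc k"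
          using d(2)[of z] x by (auto simp: dist_norm norm_minus_commute)
      qed (rule x)
      also have "\<dots> = fact k * C * x" using x by simp
      finally show ?thesis .
    qed
    then have "\<forall>\<^sub>F x in at_right 0. cmod ((deriv ^^ k) (\<lambda>z. h z - T z) c) \<le> fact k * C * x"
      unfolding eventually_at_right_field using d(1) \<delta>(1) by (intro exI[of _ "min d \<delta>"]) auto
    moreover have "((\<lambda>x. fact k * C * x) \<longlongrightarrow> fact k * C * 0) (at_right 0)"
      by (intro tendsto_intros)
    ultimately have "cmod ((deriv ^^ k) (\<lambda>z. h z - T z) c) \<le> fact k * C * 0"
      by (intro tendsto_lowerbound[of _ _ "at_right 0"]) auto
    then have "(deriv ^^ k) h c = (deriv ^^ k) T c"
      using higher_deriv_diff[OF h T\<delta> open_ball, of c k] \<delta>(1) by simp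
    moreover have "cmod ((deriv ^^ k) T c) \<le> fact k * 1 / \<rho> ^ k"
    proof (rule Cauchy_inequality)
      show "T holomorphic_on ball c \<rho>"
        using T(1) by (rule holomorphic_on_subset) (use \<rho> in auto)
      have "cball c \<rho> \<subseteq> ball c R" using \<rho> by auto
      then show "continuous_on (cball c \<rho>) T"
        using T(1) by (meson continuous_on_subset holomorphic_on_imp_continuous_on)
      show "cmod (T z) \<le> 1" if "cmod (c - z) = \<rho>" for z
        using that \<rho> by (intro T(2)) (auto simp: dist_norm)
    qed (rule \<rho>)
    ultimately show ?thesis by simp
  qed
  define a where "a = (\<lambda>k. (deriv ^^ k) h c / fact k)"
  define H where "H = (\<lambda>w. \<Sum>k. a k * (w - c) ^ k)"
  have sums: "(\<lambda>k. a k * (w - c) ^ k) sums H w" if w: "w \<in> ball c R" for w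
  proof -
    obtain \<rho> where \<rho>: "dist c w < \<rho>" "\<rho> < R" using w dense by auto
    then have "0 < \<rho>" by (meson zero_le_dist le_less_trans)
    have "summable (\<lambda>k. a k * (w - c) ^ k)"
    proof (rule summable_comparison_test')
      show "summable (\<lambda>k. (cmod (w - c) / \<rho>) ^ k)"
        using \<rho> \<open>0 < \<rho>\<close> by (intro summable_geometric) (auto simp: dist_norm norm_minus_commute)
      fix k
      have "cmod (a k) \<le> 1 / \<rho> ^ k"
        using coeff[OF \<open>0 < \<rho>\<close> \<rho>(2), of k] by (simp add: a_def norm_divide field_simps)
      then have "cmod (a k) * cmod (w - c) ^ k \<le> 1 / \<rho> ^ k * cmod (w - c) ^ k"
        by (rule mult_right_mono) simp
      then show "norm (a k * (w - c) ^ k) \<le> (cmod (w - c) / \<rho>) ^ k"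
        by (simp add: norm_mult norm_power power_divide)
    qed
    then show ?thesis unfolding H_def by (rule summable_sums)
  qed
  show ?thesis
  proof
    show "H holomorphic_on ball c R" using sums by (rule power_series_holomorphic)
    fix z assume z: "z \<in> ball c \<delta>"
    then have "(\<lambda>k. a k * (z - c) ^ k) sums h z"
      unfolding a_def by (rule holomorphic_power_series[OF h])
    moreover have "(\<lambda>k. a k * (z - c) ^ k) sums H z"
      using z \<delta>(2) by (intro sums) auto
    ultimately show "H z = h z" by (rule sums_unique2[symmetric])
  qed
qed

context automorphic_branches
begin

text \<open>
The maximum principle without decay at infinity. The values \<open>w\<close> avoid a disc around \<open>p\<close>, so
\<open>h = \<eta> / (w - p)\<close> is bounded by \<open>1\<close> and never \<open>0\<close>, while it tends to \<open>0\<close> as \<open>w\<close> tends to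
infinity. Hence \<open>cmod h * cmod G ^ k \<le> (1 + \<epsilon>) ^ k\<close> for all \<open>k\<close>, which forces
\<open>cmod G \<le> 1 + \<epsilon>\<close>.
\<close>

lemma branch_bound_at_omitted_disc:
  assumes \<eta>: "0 < \<eta>" "\<And>z w. z \<in> ball c R \<Longrightarrow> w \<in> branch_values \<Phi> z \<Longrightarrow> \<eta> \<le> cmod (w - p)"
    and hol: "holomorphic_along_branches G (ball c R - {c})"
    and bdd: "\<And>z w. z \<in> ball c R - {c} \<Longrightarrow> w \<in> branch_values \<Phi> z \<Longrightarrow> cmod (G z w) \<le> K"
    and outer: "\<And>\<epsilon>. \<epsilon> > 0 \<Longrightarrow> \<exists>R'<R. \<forall>z\<in>ball c R - {c}. R' \<le> dist c z \<longrightarrow>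
      (\<forall>w\<in>branch_values \<Phi> z. cmod (G z w) \<le> 1 + \<epsilon>)"
    and zw: "z \<in> ball c R - {c}" "w \<in> branch_values \<Phi> z"
  shows "cmod (G z w) \<le> 1"
proof (rule ccontr)
  assume "\<not> cmod (G z w) \<le> 1"
  define \<epsilon> where "\<epsilon> = (cmod (G z w) - 1) / 2"
  have \<epsilon>: "\<epsilon> > 0" "1 + \<epsilon> < cmod (G z w)"
    using \<open>\<not> cmod (G z w) \<le> 1\<close> by (simp_all add: \<epsilon>_def field_simps)
  obtain R' where R': "R' < R" "\<And>z w. z \<in> ball c R - {c} \<Longrightarrow> R' \<le> dist c z \<Longrightarrow>
      w \<in> branch_values \<Phi> z \<Longrightarrow> cmod (G z w) \<le> 1 + \<epsilon>"
    using outer[OF \<epsilon>(1)] by blast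
  have K: "0 \<le> K" using bdd[OF zw] norm_ge_zero order_trans by blast
  define h where "h = (\<lambda>w. of_real \<eta> / (w - p))"
  have h1: "cmod (h w) \<le> 1" "h w \<noteq> 0" if "z \<in> ball c R" "w \<in> branch_values \<Phi> z" for z w
    using \<eta>(2)[OF that] \<eta>(1) by (auto simp: h_def norm_divide divide_simps)
  have bound: "cmod (h w * G z w ^ k) \<le> (1 + \<epsilon>) ^ k" for k
  proof (rule branch_maximum_principle[where Q = "\<lambda>z w. h w * G z w ^ k" and R' = R' and K = "K ^ k"])
    show "holomorphic_along_branches (\<lambda>z w. h w * G z w ^ k) (ball c R - {c})"
      unfolding holomorphic_along_branches_def
    proof clarify
      fix a r \<phi> assume \<phi>: "(a, r, \<phi>) \<in> \<Phi>"
      have "\<phi> z \<noteq> p" if "z \<in> ball a r \<inter> (ball c R - {c})" for z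
      proof
        assume "\<phi> z = p"
        moreover have "\<phi> z \<in> branch_values \<Phi> z"
          using that by (intro branch_valuesI[OF \<phi>]) auto
        ultimately show False using \<eta>(2)[of z "\<phi> z"] \<eta>(1) that by simp
      qed
      moreover have "\<phi> holomorphic_on ball a r \<inter> (ball c R - {c})"
        using element_holomorphic(2)[OF \<phi>] by (rule holomorphic_on_subset) auto
      ultimately show "(\<lambda>z. h (\<phi> z) * G z (\<phi> z) ^ k) holomorphic_on ball a r \<inter> (ball c R - {c})"
        unfolding h_def
        by (intro holomorphic_intros holomorphic_along_branchesD[OF hol \<phi>]) auto
    qed
    have hG: "cmod (h w * G z w ^ k) \<le> M ^ k"
      if "z \<in> ball c R - {c}" "w \<in> branch_values \<Phi> z" "cmod (G z w) \<le> M" for z w M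
    proof -
      have "cmod (h w) * cmod (G z w) ^ k \<le> 1 * M ^ k"
        using h1(1)[of z w] that by (intro mult_mono power_mono) auto
      then show ?thesis by (simp add: norm_mult norm_power)
    qed
    show "cmod (h w * G z w ^ k) \<le> K ^ k" if "z \<in> ball c R - {c}" "w \<in> branch_values \<Phi> z" for z w
      using that bdd[OF that] by (rule hG)
    show "cmod (h w * G z w ^ k) \<le> (1 + \<epsilon>) ^ k"
      if "z \<in> ball c R - {c}" "R' \<le> dist c z" "w \<in> branch_values \<Phi> z" for z w
      using that(1,3) R'(2)[OF that] by (rule hG)
    show "\<exists>L. \<forall>z\<in>ball c R - {c}. \<forall>w\<in>branch_values \<Phi> z. e \<le> cmod (h w * G z w ^ k) \<longrightarrow> cmod w \<le> L"
      if e: "e > 0" for e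
    proof (intro exI ballI impI)
      fix z w assume z: "z \<in> ball c R - {c}" and w: "w \<in> branch_values \<Phi> z"
        and le: "e \<le> cmod (h w * G z w ^ k)"
      have "\<eta> \<le> cmod (w - p)" using z w by (intro \<eta>(2)) auto
      then have wp: "0 < cmod (w - p)" using \<eta>(1) by linarith
      have "cmod (G z w) ^ k \<le> K ^ k" using bdd[OF z w] by (rule power_mono) simp
      then have "cmod (h w) * cmod (G z w) ^ k \<le> cmod (h w) * K ^ k"
        by (rule mult_left_mono) simp
      then have "e \<le> cmod (h w) * K ^ k"
        using le by (simp add: norm_mult norm_power)
      then have "e * cmod (w - p) \<le> \<eta> * K ^ k"
        using wp \<eta>(1) by (simp add: h_def norm_divide field_simps)
      then have "cmod (w - p) \<le> \<eta> * K ^ k / e" using e by (simp add: field_simps)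
      then show "cmod w \<le> \<eta> * K ^ k / e + cmod p"
        using norm_triangle_sub[of w p] by linarith
    qed
  qed (use R'(1) \<epsilon>(1) zw in auto)
  have "cmod (h w) > 0" using h1(2)[of z w] zw by simp
  obtain k where k: "1 / cmod (h w) < (cmod (G z w) / (1 + \<epsilon>)) ^ k"
    using real_arch_pow[of "cmod (G z w) / (1 + \<epsilon>)" "1 / cmod (h w)"] \<epsilon> by auto
  have "cmod (h w) * cmod (G z w) ^ k \<le> (1 + \<epsilon>) ^ k"
    using bound[of k] by (simp add: norm_mult norm_power)
  then show False
    using k \<open>cmod (h w) > 0\<close> \<epsilon>(1) by (simp add: power_divide field_simps)
qed

text \<open>
The algorithm of Schur, carried out on the surface. Let \<open>\<gamma>\<close> be the limit of \<open>G\<close> over \<open>c\<close>. The function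
\<open>G1 = R / (z - c) * disc_automorphism \<gamma> G\<close> is again bounded by \<open>1\<close>: single-valuedness near \<open>c\<close>
makes it bounded there, at the outer boundary the factor \<open>R / (z - c)\<close> tends to modulus \<open>1\<close>, and
\<open>branch_bound_at_omitted_disc\<close> applies.
Undoing the step for an interpolant of \<open>G1\<close> of order \<open>N\<close> gives one of \<open>G\<close> of order \<open>N + 1\<close>.
\<close>

lemma schur_interpolation:
  assumes \<eta>: "0 < \<eta>" "\<And>z w. z \<in> ball c R \<Longrightarrow> w \<in> branch_values \<Phi> z \<Longrightarrow> \<eta> \<le> cmod (w - p)"
    and \<phi>: "(a, r, \<phi>) \<in> \<Phi>" "ball c \<delta> \<subseteq> ball a r" and \<delta>: "0 < \<delta>" "\<delta> \<le> R"
    and single: "\<And>z w. z \<in> ball c \<delta> \<Longrightarrow> w \<in> branch_values \<Phi> z \<Longrightarrow> w = \<phi> z"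
    and hol: "holomorphic_along_branches G (ball c R - {c})"
    and le1: "\<And>z w. z \<in> ball c R - {c} \<Longrightarrow> w \<in> branch_values \<Phi> z \<Longrightarrow> cmod (G z w) \<le> 1"
  shows "\<exists>T C. T holomorphic_on ball c R \<and> (\<forall>z\<in>ball c R. cmod (T z) \<le> 1) \<and>
      (\<forall>\<^sub>F z in at c. cmod (G z (\<phi> z) - T z) \<le> C * cmod (z - c) ^ N)"
  using hol le1
proof (induction N arbitrary: G)
  case 0
  have bv: "\<phi> z \<in> branch_values \<Phi> z" if "z \<in> ball c \<delta>" for z
    using \<phi>(2) that by (intro branch_valuesI[OF \<phi>(1)]) auto
  have "\<forall>\<^sub>F z in at c. cmod (G z (\<phi> z)) \<le> 1"
    unfolding eventually_at using \<delta> bv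
    by (intro exI[of _ \<delta>]) (auto intro!: "0.prems"(2) simp: dist_commute)
  then show ?case
    by (intro exI[of _ "\<lambda>_. 0"] exI[of _ 1]) auto
next
  case (Suc N)
  have R: "0 < R" using \<delta> by simp
  have bv: "\<phi> z \<in> branch_values \<Phi> z" if "z \<in> ball c \<delta>" for z
    using \<phi>(2) that by (intro branch_valuesI[OF \<phi>(1)]) auto
  have "(\<lambda>z. G z (\<phi> z)) holomorphic_on ball c \<delta> - {c}"
    using holomorphic_along_branchesD[OF Suc.prems(1) \<phi>(1)]
    by (rule holomorphic_on_subset) (use \<phi>(2) \<delta> in auto)
  moreover have "\<forall>\<^sub>F z in at c. cmod (G z (\<phi> z)) \<le> 1"
    unfolding eventually_at using \<delta> bv
    by (intro exI[of _ \<delta>]) (auto intro!: Suc.prems(2) simp: dist_commute)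
  ultimately obtain g where g: "g holomorphic_on ball c \<delta>" "\<And>z. z \<in> ball c \<delta> - {c} \<Longrightarrow> g z = G z (\<phi> z)"
    using holomorphic_on_extend_bounded[of "\<lambda>z. G z (\<phi> z)" "ball c \<delta>" c] \<delta>(1) by auto
  have g1': "cmod (g z) \<le> 1" if "z \<in> ball c \<delta> - {c}" for z
    using g(2)[OF that] Suc.prems(2)[of z "\<phi> z"] bv[of z] that \<delta>(2) by auto
  define \<gamma> where "\<gamma> = g c"
  have "cmod \<gamma> \<le> 1"
  proof -
    have "isCont g c"
      using g(1) \<delta>(1) by (meson centre_in_ball continuous_on_eq_continuous_at holomorphic_on_imp_continuous_on open_ball)
    then have "((\<lambda>z. cmod (g z)) \<longlongrightarrow> cmod (g c)) (at c)"
      unfolding isCont_def by (rule tendsto_norm)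
    moreover have "\<forall>\<^sub>F z in at c. cmod (g z) \<le> 1"
      unfolding eventually_at using \<delta> g1' by (intro exI[of _ \<delta>]) (auto simp: dist_commute)
    ultimately show ?thesis
      unfolding \<gamma>_def by (intro tendsto_upperbound[of _ _ "at c"]) auto
  qed
  then have g1: "cmod (g z) \<le> 1" if "z \<in> ball c \<delta>" for z
    using g1' that by (cases "z = c") (auto simp: \<gamma>_def)
  show ?case
  proof (cases "cmod \<gamma> = 1")
    case True
    \<comment> \<open>The algorithm stops at a value of modulus \<open>1\<close>: \<open>G\<close> is then
      constant near \<open>c\<close>.\<close>
    have "g constant_on ball c \<delta>"
    proof (rule maximum_modulus_principle[OF g(1) open_ball _ open_ball order_refl])
      show "cmod (g z) \<le> cmod (g c)" if "z \<in> ball c \<delta>" for z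
        using g1[OF that] True by (simp add: \<gamma>_def)
    qed (use \<delta> in auto)
    then have const: "g z = \<gamma>" if "z \<in> ball c \<delta>" for z
      using that \<delta>(1) unfolding constant_on_def \<gamma>_def by auto
    have "\<forall>\<^sub>F z in at c. cmod (G z (\<phi> z) - \<gamma>) \<le> 0 * cmod (z - c) ^ Suc N"
      unfolding eventually_at
    proof (intro exI[of _ \<delta>] conjI ballI impI)
      fix z assume "z \<noteq> c \<and> dist z c < \<delta>"
      then have "z \<in> ball c \<delta> - {c}" by (auto simp: dist_commute)
      then show "cmod (G z (\<phi> z) - \<gamma>) \<le> 0 * cmod (z - c) ^ Suc N"
        using g(2)[of z] const[of z] by auto
    qed (rule \<delta>)
    then show ?thesis
      using \<open>cmod \<gamma> \<le> 1\<close> by (intro exI[of _ "\<lambda>_. \<gamma>"] exI[of _ 0]) auto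
  next
    case False
    then have \<gamma>: "cmod \<gamma> < 1" using \<open>cmod \<gamma> \<le> 1\<close> by simp
    define G1 where "G1 = (\<lambda>z w. of_real R / (z - c) * disc_automorphism \<gamma> (G z w))"
    have hol1: "holomorphic_along_branches G1 (ball c R - {c})"
      unfolding holomorphic_along_branches_def
    proof clarify
      fix b s \<psi> assume \<psi>: "(b, s, \<psi>) \<in> \<Phi>"
      have "cmod (G z (\<psi> z)) \<le> 1" if "z \<in> ball b s \<inter> (ball c R - {c})" for z
        using that by (intro Suc.prems(2) branch_valuesI[OF \<psi>]) auto
      then have "(\<lambda>z. disc_automorphism \<gamma> (G z (\<psi> z))) holomorphic_on ball b s \<inter> (ball c R - {c})"
        by (intro disc_automorphism_holomorphic \<gamma> holomorphic_along_branchesD[OF Suc.prems(1) \<psi>])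
      then show "(\<lambda>z. G1 z (\<psi> z)) holomorphic_on ball b s \<inter> (ball c R - {c})"
        unfolding G1_def by (intro holomorphic_intros) auto
    qed
    have da1: "cmod (disc_automorphism \<gamma> (G z w)) \<le> 1"
      if "z \<in> ball c R - {c}" "w \<in> branch_values \<Phi> z" for z w
      using cmod_disc_automorphism_le[OF \<gamma> Suc.prems(2)[OF that]] .
    have hg: "(\<lambda>z. disc_automorphism \<gamma> (g z)) holomorphic_on ball c \<delta>"
      by (intro disc_automorphism_holomorphic \<gamma> g(1) g1)
    have "disc_automorphism \<gamma> (g c) = 0"
      by (simp add: disc_automorphism_def \<gamma>_def)
    then obtain d L where d: "0 < d"
      "\<And>z. z \<noteq> c \<Longrightarrow> dist c z < d \<Longrightarrow> cmod (disc_automorphism \<gamma> (g z) / (z - c)) \<le> L"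
      by (rule holomorphic_zero_quotient_bounded[OF hg \<delta>(1)]) blast
    define d' where "d' = min d \<delta>"
    have d': "0 < d'" using d \<delta> by (simp add: d'_def)
    have bdd1: "cmod (G1 z w) \<le> max (R * L) (R / d')"
      if z: "z \<in> ball c R - {c}" and w: "w \<in> branch_values \<Phi> z" for z w
    proof (cases "dist c z < d'")
      case True
      then have z': "z \<in> ball c \<delta> - {c}" "dist c z < d" using z by (auto simp: d'_def)
      then have "w = \<phi> z" using single w by blast
      then have "G z w = g z" using g(2)[OF z'(1)] by simp
      then have "cmod (G1 z w) = R * cmod (disc_automorphism \<gamma> (g z) / (z - c))"
        using R by (simp add: G1_def norm_mult norm_divide)
      also have "\<dots> \<le> R * L"
        using d(2)[of z] z' R by (intro mult_left_mono) auto
      finally show ?thesis by simp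
    next
      case False
      have "cmod (G1 z w) = R / dist c z * cmod (disc_automorphism \<gamma> (G z w))"
        using R by (simp add: G1_def norm_mult norm_divide dist_norm norm_minus_commute)
      also have "\<dots> \<le> R / d' * 1"
        using False d' R da1[OF z w] z by (intro mult_mono divide_left_mono mult_pos_pos) auto
      finally show ?thesis by simp
    qed
    have G1_le: "cmod (G1 z w) \<le> 1" if "z \<in> ball c R - {c}" "w \<in> branch_values \<Phi> z" for z w
    proof (rule branch_bound_at_omitted_disc[OF \<eta> hol1 bdd1 _ that])
      fix \<epsilon> :: real assume \<epsilon>: "\<epsilon> > 0"
      show "\<exists>R'<R. \<forall>z\<in>ball c R - {c}. R' \<le> dist c z \<longrightarrow> (\<forall>w\<in>branch_values \<Phi> z. cmod (G1 z w) \<le> 1 + \<epsilon>)"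
      proof (intro exI[of _ "R / (1 + \<epsilon>)"] conjI ballI impI)
        show "R / (1 + \<epsilon>) < R" using R \<epsilon> by (simp add: field_simps)
        fix z w assume z: "z \<in> ball c R - {c}" and w: "w \<in> branch_values \<Phi> z"
          and ge: "R / (1 + \<epsilon>) \<le> dist c z"
        have "cmod (G1 z w) = R / dist c z * cmod (disc_automorphism \<gamma> (G z w))"
          using R by (simp add: G1_def norm_mult norm_divide dist_norm norm_minus_commute)
        also have "\<dots> \<le> (1 + \<epsilon>) * 1"
        proof (intro mult_mono da1[OF z w])
          have "0 < dist c z" using z by auto
          then show "R / dist c z \<le> 1 + \<epsilon>"
            using ge \<epsilon> by (simp add: field_simps)
        qed (use \<epsilon> in auto)
        finally show "cmod (G1 z w) \<le> 1 + \<epsilon>" by simp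
      qed
    qed
    obtain T1 C1 where T1: "T1 holomorphic_on ball c R" "\<And>z. z \<in> ball c R \<Longrightarrow> cmod (T1 z) \<le> 1"
      and ev1: "\<forall>\<^sub>F z in at c. cmod (G1 z (\<phi> z) - T1 z) \<le> C1 * cmod (z - c) ^ N"
      using Suc.IH[OF hol1 G1_le] by blast
    define y where "y = (\<lambda>z. (z - c) / of_real R * T1 z)"
    have y1: "cmod (y z) \<le> 1" if "z \<in> ball c R" for z
    proof -
      have "cmod (z - c) / R * cmod (T1 z) \<le> 1 * 1"
        using that R T1(2)[OF that] by (intro mult_mono) (auto simp: dist_norm norm_minus_commute)
      then show ?thesis using R by (simp add: y_def norm_mult norm_divide)
    qed
    have "y holomorphic_on ball c R"
      unfolding y_def using R by (intro holomorphic_intros T1) auto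
    then have "(\<lambda>z. disc_automorphism (- \<gamma>) (y z)) holomorphic_on ball c R"
      using \<gamma> y1 by (intro disc_automorphism_holomorphic) auto
    moreover have "\<forall>z\<in>ball c R. cmod (disc_automorphism (- \<gamma>) (y z)) \<le> 1"
      using \<gamma> y1 by (auto intro!: cmod_disc_automorphism_le)
    moreover have "\<forall>\<^sub>F z in at c. cmod (G z (\<phi> z) - disc_automorphism (- \<gamma>) (y z)) \<le>
        (C1 / R / (1 - cmod \<gamma>)\<^sup>2) * cmod (z - c) ^ Suc N"
    proof -
      have "\<forall>\<^sub>F z in at c. z \<in> ball c \<delta> - {c}"
        unfolding eventually_at using \<delta>(1) by (auto simp: dist_commute)
      then show ?thesis
        using ev1
      proof eventually_elim
        case (elim z)
        then have z: "z \<in> ball c R - {c}" "z \<noteq> c" using \<delta>(2) by auto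
        define x where "x = disc_automorphism \<gamma> (G z (\<phi> z))"
        have x1: "cmod x \<le> 1" unfolding x_def using da1 z bv elim by blast
        have "x = (z - c) / of_real R * G1 z (\<phi> z)"
          using z R by (simp add: G1_def x_def)
        then have "x - y z = (z - c) / of_real R * (G1 z (\<phi> z) - T1 z)"
          by (simp add: y_def algebra_simps)
        then have "cmod (x - y z) = cmod (z - c) / R * cmod (G1 z (\<phi> z) - T1 z)"
          using R by (simp add: norm_mult norm_divide)
        also have "\<dots> \<le> cmod (z - c) / R * (C1 * cmod (z - c) ^ N)"
          using elim(2) R by (intro mult_left_mono) auto
        finally have xy: "cmod (x - y z) \<le> C1 / R * cmod (z - c) ^ Suc N"
          by (simp add: mult_ac)
        have "G z (\<phi> z) = disc_automorphism (- \<gamma>) x"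
          unfolding x_def using disc_automorphism_inverse[OF \<gamma>] Suc.prems(2) z bv elim(1) by auto
        then have "cmod (G z (\<phi> z) - disc_automorphism (- \<gamma>) (y z)) \<le> cmod (x - y z) / (1 - cmod \<gamma>)\<^sup>2"
          using disc_automorphism_lipschitz[of "- \<gamma>" x "y z"] \<gamma> x1 y1 z by simp
        also have "\<dots> \<le> (C1 / R * cmod (z - c) ^ Suc N) / (1 - cmod \<gamma>)\<^sup>2"
          using xy by (intro divide_right_mono) auto
        finally show ?case by simp
      qed
    qed
    ultimately show ?thesis by blast
  qed
qed

end

section \<open>Single-valued branches are entire\<close>

lemma entire_bounded_near_infinity_imp_constant:
  fixes f :: "complex \<Rightarrow> complex"
  assumes f: "f holomorphic_on UNIV" and "\<And>w. cmod w \<ge> L \<Longrightarrow> cmod (f w) \<le> B"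
  shows "f constant_on UNIV"
proof (rule Liouville_theorem[OF f])
  have "compact (f ` cball 0 L)"
    using f by (intro compact_continuous_image holomorphic_on_imp_continuous_on)
      (auto intro: holomorphic_on_subset)
  then have "bounded (f ` cball 0 L \<union> cball 0 B)"
    by (simp add: compact_imp_bounded)
  moreover have "range f \<subseteq> f ` cball 0 L \<union> cball 0 B"
  proof
    fix y assume "y \<in> range f"
    then obtain x where "y = f x" by blast
    then show "y \<in> f ` cball 0 L \<union> cball 0 B"
      using assms(2)[of x] by (cases "cmod x \<le> L") auto
  qed
  ultimately show "bounded (range f)" by (rule bounded_subset)
qed

context automorphic_branches
begin

text \<open>
Near a zero of \<open>H\<close> the function \<open>p + \<eta> / H\<close> takes all large values, at which \<open>f\<close> would then be
bounded by its maximum over a compact disc.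
\<close>

lemma meromorphic_automorphism_has_no_pole:
  assumes H: "H holomorphic_on ball c R" and "ball b e \<subseteq> ball c R" "e > 0"
    and H0: "\<And>z. z \<in> ball b e \<Longrightarrow> H z \<noteq> 0"
    and fH: "\<And>z. z \<in> ball b e \<Longrightarrow> f (p + of_real \<eta> / H z) = f z" and "\<eta> > 0"
    and z: "z \<in> ball c R"
  shows "H z \<noteq> 0"
proof
  assume Hz: "H z = 0"
  \<comment> \<open>Removing the countably many zeros of \<open>H\<close> leaves a connected set, on which
    \<open>f (p + \<eta> / H x) = f x\<close> spreads.\<close>
  define D where "D = ball c R - {z \<in> ball c R. H z = 0}"
  have "b \<in> ball b e" using assms(3) by simp
  then have bR: "b \<in> ball c R" using assms(2) by blast
  have nc: "\<not> H constant_on ball c R"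
    using Hz z bR H0[OF \<open>b \<in> ball b e\<close>] unfolding constant_on_def by metis
  have "D = ball c R \<inter> H -` (- {0})" by (auto simp: D_def)
  then have "open D"
    using continuous_open_preimage[OF holomorphic_on_imp_continuous_on[OF H] open_ball, of "- {0}"] by auto
  obtain K :: "nat \<Rightarrow> complex set" where "\<And>n. compact (K n)" "(\<Union>n. K n) = ball c R"
    by (rule open_Union_compact_subsets[OF open_ball[of c R]]) (rule that)
  then have "fsigma (ball c R)"
    unfolding fsigma_Union_compact by (intro exI[of _ K]) auto
  then have "connected D"
    unfolding D_def
    by (intro connected_open_diff_countable holomorphic_countable_zeros[OF H])
      (use nc in auto)
  have f_comp: "(\<lambda>z. f (g z)) holomorphic_on D" if "g holomorphic_on D" for g
    using holomorphic_on_compose_gen[OF that entire] by (simp add: comp_def)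
  have HD: "H holomorphic_on D" using H by (rule holomorphic_on_subset) (auto simp: D_def)
  have feq: "f (p + of_real \<eta> / H x) = f x" if "x \<in> D" for x
  proof (rule analytic_continuation_open[of "ball b e" D "\<lambda>x. f (p + of_real \<eta> / H x)" f])
    show "(\<lambda>x. f (p + of_real \<eta> / H x)) holomorphic_on D"
      by (intro f_comp holomorphic_intros HD) (auto simp: D_def)
    show "f holomorphic_on D" using entire by (rule holomorphic_on_subset) auto
    show "ball b e \<subseteq> D" using assms(2) H0 by (auto simp: D_def)
  qed (use \<open>open D\<close> \<open>connected D\<close> assms(3) fH that in auto)
  obtain \<rho> where \<rho>: "\<rho> > 0" "cball z \<rho> \<subseteq> ball c R"
    using z open_contains_cball[of "ball c R"] open_ball by blast
  have "open (H ` ball z \<rho>)"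
    using \<rho> by (intro open_mapping_thm[OF H _ _ _ _ nc]) auto
  moreover have "0 \<in> H ` ball z \<rho>" using Hz \<rho>(1) by force
  ultimately obtain d where d: "d > 0" "ball 0 d \<subseteq> H ` ball z \<rho>" using openE by blast
  have "compact (f ` cball z \<rho>)"
    using entire by (intro compact_continuous_image holomorphic_on_imp_continuous_on)
      (auto intro: holomorphic_on_subset)
  then obtain B where B: "\<And>x. x \<in> cball z \<rho> \<Longrightarrow> cmod (f x) \<le> B"
    using compact_imp_bounded bounded_iff by (metis imageI)
  have "f constant_on UNIV"
  proof (rule entire_bounded_near_infinity_imp_constant[OF entire])
    fix w assume w: "cmod w \<ge> cmod p + \<eta> / d + 1"
    then have wp: "cmod (w - p) > \<eta> / d"
      using norm_triangle_sub[of w p] by linarith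
    then have pos: "cmod (w - p) > 0" using \<open>\<eta> > 0\<close> d(1) by (meson divide_pos_pos order.strict_trans)
    have "\<eta> / cmod (w - p) < d"
      using wp pos d(1) by (simp add: field_simps)
    then have "of_real \<eta> / (w - p) \<in> ball 0 d"
      using \<open>\<eta> > 0\<close> by (simp add: norm_divide)
    then obtain x where x: "x \<in> ball z \<rho>" "of_real \<eta> / (w - p) = H x" using d(2) by blast
    have "H x \<noteq> 0" using x(2) pos \<open>\<eta> > 0\<close> by auto
    moreover have "x \<in> ball c R" using x(1) \<rho>(2) ball_subset_cball by blast
    ultimately have "x \<in> D" by (simp add: D_def)
    moreover have "p + of_real \<eta> / H x = w"
      using pos \<open>\<eta> > 0\<close> by (simp flip: x(2))
    ultimately have "f w = f x" using feq[of x] by simp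
    then show "cmod (f w) \<le> B" using B[of x] x(1) by simp
  qed
  then show False using nonconstant by blast
qed

text \<open>
As \<open>f w = f z\<close>, any \<open>p\<close> where \<open>cmod (f p)\<close> exceeds the maximum of \<open>cmod f\<close> over \<open>cball c R\<close>
will do.
\<close>

lemma omitted_disc_exists:
  obtains p \<eta> where "0 < \<eta>" "\<And>z w. z \<in> ball c R \<Longrightarrow> w \<in> branch_values \<Phi> z \<Longrightarrow> \<eta> \<le> cmod (w - p)"
proof -
  have "compact (f ` cball c R)"
    using entire by (intro compact_continuous_image holomorphic_on_imp_continuous_on)
      (auto intro: holomorphic_on_subset)
  then obtain B where B: "\<And>x. x \<in> cball c R \<Longrightarrow> cmod (f x) \<le> B"
    using compact_imp_bounded bounded_iff by (metis imageI)
  obtain p where p: "cmod (f p) > B"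
    using entire_bounded_near_infinity_imp_constant[OF entire, of 0 B] nonconstant by (meson not_le)
  have "isCont (\<lambda>w. cmod (f w)) p"
    using entire by (intro continuous_norm)
      (meson continuous_on_eq_continuous_at holomorphic_on_imp_continuous_on open_UNIV UNIV_I)
  then have "\<forall>\<^sub>F w in nhds p. cmod (f w) \<in> {B<..}"
    by (rule isCont_eventually_in_open) (use p in auto)
  then obtain \<eta> where \<eta>: "\<eta> > 0" "\<And>w. dist w p < \<eta> \<Longrightarrow> cmod (f w) > B"
    unfolding eventually_nhds_metric by auto
  show ?thesis
  proof (rule that[OF \<eta>(1)])
    fix z w assume "z \<in> ball c R" "w \<in> branch_values \<Phi> z"
    then have "cmod (f w) \<le> B" using automorphic_value B[of z] by auto
    then show "\<eta> \<le> cmod (w - p)" using \<eta>(2)[of w] by (auto simp: dist_norm not_le[symmetric])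
  qed
qed

text \<open>
Interpolation applied to \<open>h = \<eta> / (w - p)\<close> extends \<open>h \<circ> \<phi>\<close> to the disc as a function \<open>H\<close>, and
\<open>p + \<eta> / H\<close> extends \<open>\<phi>\<close>.
\<close>

lemma single_valued_branch_extends_to_ball:
  assumes \<phi>: "(a, r, \<phi>) \<in> \<Phi>" "ball c \<delta> \<subseteq> ball a r" and \<delta>: "0 < \<delta>" "\<delta> \<le> R"
    and single: "\<And>z w. z \<in> ball c \<delta> \<Longrightarrow> w \<in> branch_values \<Phi> z \<Longrightarrow> w = \<phi> z"
  obtains \<psi> where "\<psi> holomorphic_on ball c R" "\<And>z. z \<in> ball c \<delta> \<Longrightarrow> \<psi> z = \<phi> z"
proof -
  obtain p \<eta> where \<eta>: "0 < \<eta>" "\<And>z w. z \<in> ball c R \<Longrightarrow> w \<in> branch_values \<Phi> z \<Longrightarrow> \<eta> \<le> cmod (w - p)"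
    by (rule omitted_disc_exists[of c R]) (rule that)
  define h where "h = (\<lambda>w. of_real \<eta> / (w - p))"
  have ne: "w \<noteq> p" "cmod (h w) \<le> 1" if "z \<in> ball c R" "w \<in> branch_values \<Phi> z" for z w
  proof -
    have "0 < cmod (w - p)" using \<eta>(2)[OF that] \<eta>(1) by linarith
    then show "w \<noteq> p" "cmod (h w) \<le> 1"
      using \<eta>(2)[OF that] \<eta>(1) by (auto simp: h_def norm_divide)
  qed
  have h\<psi>: "(\<lambda>z. h (\<psi> z)) holomorphic_on S" if "(b, s, \<psi>) \<in> \<Phi>" "S \<subseteq> ball b s" "S \<subseteq> ball c R" for b s \<psi> S
  proof -
    have "\<psi> holomorphic_on S"
      using element_holomorphic(2)[OF that(1)] that(2) by (rule holomorphic_on_subset)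
    moreover have "\<psi> z \<noteq> p" if "z \<in> S" for z
      using ne(1)[OF _ branch_valuesI[OF \<open>(b, s, \<psi>) \<in> \<Phi>\<close>]] that \<open>S \<subseteq> ball b s\<close> \<open>S \<subseteq> ball c R\<close> by blast
    ultimately show ?thesis unfolding h_def by (intro holomorphic_intros) auto
  qed
  have sub: "ball c \<delta> \<subseteq> ball c R" by (rule subset_ball[OF \<delta>(2)])
  obtain H where H: "H holomorphic_on ball c R" "\<And>z. z \<in> ball c \<delta> \<Longrightarrow> H z = h (\<phi> z)"
  proof (rule bounded_interpolants_imp_extension[OF h\<psi>[OF \<phi> sub] \<delta>])
    fix N
    show "\<exists>T C. T holomorphic_on ball c R \<and> (\<forall>z\<in>ball c R. cmod (T z) \<le> 1) \<and>
        (\<forall>\<^sub>F z in at c. cmod (h (\<phi> z) - T z) \<le> C * cmod (z - c) ^ N)"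
    proof (rule schur_interpolation[OF \<eta> \<phi> \<delta> single, where G = "\<lambda>_. h"])
      show "holomorphic_along_branches (\<lambda>_. h) (ball c R - {c})"
        unfolding holomorphic_along_branches_def by (auto intro!: h\<psi>)
    qed (use ne(2) in auto)
  qed (rule that)
  have \<phi>H: "\<phi> z = p + of_real \<eta> / H z" "H z \<noteq> 0" if "z \<in> ball c \<delta>" for z
  proof -
    have "\<phi> z \<noteq> p" using ne(1)[OF _ branch_valuesI[OF \<phi>(1)]] that \<phi>(2) sub by blast
    then show "\<phi> z = p + of_real \<eta> / H z" "H z \<noteq> 0"
      using H(2)[OF that] \<eta>(1) by (auto simp: h_def)
  qed
  have H0: "H z \<noteq> 0" if "z \<in> ball c R" for z
  proof (rule meromorphic_automorphism_has_no_pole[OF H(1) sub \<delta>(1) _ _ \<eta>(1) that])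
    show "f (p + of_real \<eta> / H z) = f z" if "z \<in> ball c \<delta>" for z
      using automorphic[OF \<phi>(1), of z] \<phi>(2) \<phi>H(1)[OF that] that by auto
  qed (use \<phi>H in auto)
  show ?thesis
  proof (rule that[of "\<lambda>z. p + of_real \<eta> / H z"])
    show "(\<lambda>z. p + of_real \<eta> / H z) holomorphic_on ball c R"
      using H0 by (intro holomorphic_intros H(1)) auto
  qed (use \<phi>H in auto)
qed

text \<open>
The Taylor series of \<open>\<phi>\<close> at \<open>c\<close> is that of its extension to \<open>ball c R\<close>, so it converges there; this
holds for all \<open>R\<close>.
\<close>

lemma single_valued_branch_is_entire:
  assumes \<phi>: "(a, r, \<phi>) \<in> \<Phi>" "ball c \<delta> \<subseteq> ball a r" and \<delta>: "0 < \<delta>"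
    and single: "\<And>z w. z \<in> ball c \<delta> \<Longrightarrow> w \<in> branch_values \<Phi> z \<Longrightarrow> w = \<phi> z"
  obtains \<Psi> where "\<Psi> holomorphic_on UNIV" "\<And>z. z \<in> ball c \<delta> \<Longrightarrow> \<Psi> z = \<phi> z"
proof -
  define \<Psi> where "\<Psi> = (\<lambda>w. \<Sum>k. (deriv ^^ k) \<phi> c / fact k * (w - c) ^ k)"
  have sums: "(\<lambda>k. (deriv ^^ k) \<phi> c / fact k * (w - c) ^ k) sums \<psi> w"
    if \<psi>: "\<psi> holomorphic_on ball c R" "\<And>z. z \<in> ball c \<delta> \<Longrightarrow> \<psi> z = \<phi> z" and w: "w \<in> ball c R" for \<psi> R w
  proof -
    have "\<forall>\<^sub>F z in nhds c. z \<in> ball c \<delta>" using \<delta> by (intro eventually_nhds_in_open) auto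
    then have ev: "\<forall>\<^sub>F z in nhds c. \<psi> z = \<phi> z" by eventually_elim (rule \<psi>(2))
    have "(deriv ^^ k) \<psi> c = (deriv ^^ k) \<phi> c" for k
      by (rule higher_deriv_cong_ev[OF ev refl])
    then show ?thesis using holomorphic_power_series[OF \<psi>(1) w] by simp
  qed
  have sums_\<Psi>: "(\<lambda>k. (deriv ^^ k) \<phi> c / fact k * (w - c) ^ k) sums \<Psi> w" for w
  proof -
    obtain \<psi> where "\<psi> holomorphic_on ball c (max \<delta> (dist c w + 1))" "\<And>z. z \<in> ball c \<delta> \<Longrightarrow> \<psi> z = \<phi> z"
      by (rule single_valued_branch_extends_to_ball[OF \<phi> \<delta> max.cobounded1[of \<delta> "dist c w + 1"] single]; (assumption | rule that))
    then have "(\<lambda>k. (deriv ^^ k) \<phi> c / fact k * (w - c) ^ k) sums \<psi> w"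
      by (rule sums) (auto simp: less_max_iff_disj)
    then show ?thesis unfolding \<Psi>_def by (intro summable_sums) (rule sums_summable)
  qed
  show ?thesis
  proof
    have "\<Psi> field_differentiable at z" for z
    proof (rule holomorphic_on_imp_differentiable_at)
      show "\<Psi> holomorphic_on ball c (dist c z + 1)"
        by (rule power_series_holomorphic[OF sums_\<Psi>])
    qed auto
    then show "\<Psi> holomorphic_on UNIV" by (simp add: holomorphic_on_def)
    fix z assume z: "z \<in> ball c \<delta>"
    have "\<phi> holomorphic_on ball c \<delta>"
      using element_holomorphic(2)[OF \<phi>(1)] \<phi>(2) by (rule holomorphic_on_subset)
    then have "(\<lambda>k. (deriv ^^ k) \<phi> c / fact k * (z - c) ^ k) sums \<phi> z"
      by (rule sums) (use z in auto)
    then show "\<Psi> z = \<phi> z" using sums_\<Psi> sums_unique2 by blast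
  qed
qed

text \<open>
Being a restriction of \<open>\<Psi>\<close> passes from an element to each of its direct continuations. Since these
are symmetric, it passes from the given element back to the one that generates \<open>\<Phi>\<close>, and from there
to all others.
\<close>

lemma branches_of_entire_germ:
  assumes \<Psi>: "\<Psi> holomorphic_on UNIV" and E1: "(a, r, \<phi>) \<in> \<Phi>" "\<And>z. z \<in> ball a r \<Longrightarrow> \<phi> z = \<Psi> z"
  shows "branch_values \<Phi> z = {\<Psi> z}"
proof -
  define P where "P = (\<lambda>(a, r, \<phi>). \<forall>z\<in>ball a r. \<phi> z = \<Psi> (z::complex))"
  have step: "P E'" if dc: "direct_continuation E E'" and "P E" for E E'
  proof -
    obtain a r \<phi> b s \<psi> where EE: "E = (a, r, \<phi>)" "E' = (b, s, \<psi>)" by (cases E; cases E')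
    then have "ball a r \<inter> ball b s \<noteq> {}" using dc by simp
    then obtain z0 where z0: "z0 \<in> ball a r \<inter> ball b s" by blast
    have \<psi>: "\<psi> holomorphic_on ball b s" using dc EE by auto
    have "\<psi> z = \<Psi> z" if "z \<in> ball b s" for z
    proof (rule analytic_continuation_open[of "ball a r \<inter> ball b s" "ball b s" \<psi> \<Psi>])
      show "\<psi> z = \<Psi> z" if "z \<in> ball a r \<inter> ball b s" for z
        using dc \<open>P E\<close> EE that by (auto simp: P_def)
      show "\<Psi> holomorphic_on ball b s" using \<Psi> by (rule holomorphic_on_subset) simp
    qed (use z0 \<psi> that in auto)
    then show ?thesis by (simp add: P_def EE)
  qed
  obtain E0 where E0: "\<Phi> = complete_analytic_function E0"
    using Aut unfolding Aut_def many_valued_analytic_def by blast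
  have "direct_continuation\<^sup>*\<^sup>* E0 (a, r, \<phi>)"
    using E1(1) E0 by (simp add: complete_analytic_function_def)
  moreover have "P (a, r, \<phi>)" using E1(2) by (simp add: P_def)
  ultimately have "P E0"
    by (induction rule: converse_rtranclp_induct) (auto intro: step direct_continuation_sym)
  have PE: "P E" if "E \<in> \<Phi>" for E
  proof -
    have "direct_continuation\<^sup>*\<^sup>* E0 E" using that E0 by (simp add: complete_analytic_function_def)
    then show ?thesis by induction (use \<open>P E0\<close> step in auto)
  qed
  have "(a, dist a z + r, \<Psi>) \<in> \<Phi>"
  proof (rule continuation_by_germ[OF E1(1)])
    have r: "0 < r" using element_holomorphic[OF E1(1)] by simp
    then show "a \<in> ball a r" "a \<in> ball a (dist a z + r)" by (auto simp: add_nonneg_pos)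
    have "\<forall>\<^sub>F x in nhds a. x \<in> ball a r" using r by (intro eventually_nhds_in_open) auto
    then show "\<forall>\<^sub>F x in nhds a. \<phi> x = \<Psi> x" by eventually_elim (rule E1(2))
    show "\<Psi> holomorphic_on ball a (dist a z + r)" using \<Psi> by (rule holomorphic_on_subset) simp
  qed
  moreover have "z \<in> ball a (dist a z + r)" using element_holomorphic(1)[OF E1(1)] by simp
  ultimately have "\<Psi> z \<in> branch_values \<Phi> z" by (rule branch_valuesI)
  moreover have "w = \<Psi> z" if "w \<in> branch_values \<Phi> z" for w
    using that PE unfolding branch_values_def P_def by fastforce
  ultimately show ?thesis by blast
qed

end

section \<open>Entire solutions of the automorphic equation\<close>

text \<open>
Otherwise every value of \<open>f\<close> on the circle of radius \<open>\<rho>\<close> would be a value of \<open>f\<close> on the smaller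
disc \<open>cball 0 r\<close>, against the maximum modulus principle.
\<close>

lemma invariant_map_omits_point_on_circle:
  fixes f \<Psi> :: "complex \<Rightarrow> complex"
  assumes f: "f holomorphic_on UNIV" "\<not> f constant_on UNIV"
    and inv: "\<And>z. f (\<Psi> z) = f z" and r: "0 \<le> r" "r < \<rho>"
  obtains w where "cmod w = \<rho>" "w \<notin> \<Psi> ` cball 0 r"
proof (rule ccontr)
  assume "\<not> thesis"
  then have cover: "\<And>w. cmod w = \<rho> \<Longrightarrow> w \<in> \<Psi> ` cball 0 r"
    using that by blast
  have contf: "continuous_on S f" for S
    using f(1) by (meson continuous_on_subset holomorphic_on_imp_continuous_on subset_UNIV)
  have "continuous_on (cball 0 r) (\<lambda>z. cmod (f z))"
    by (intro continuous_on_norm contf)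
  then obtain z0 where z0: "z0 \<in> cball 0 r" "\<And>z. z \<in> cball 0 r \<Longrightarrow> cmod (f z) \<le> cmod (f z0)"
    using continuous_attains_sup[of "cball 0 r" "\<lambda>z. cmod (f z)"] r(1) by (auto simp: Ball_def)
  have "f constant_on UNIV"
  proof (rule maximum_modulus_principle[OF f(1) open_UNIV connected_UNIV open_ball])
    show "z0 \<in> ball 0 \<rho>" using z0(1) r(2) by simp
    show "cmod (f z) \<le> cmod (f z0)" if z: "z \<in> ball 0 \<rho>" for z
    proof (rule maximum_modulus_frontier[of f "cball 0 \<rho>"])
      show "f holomorphic_on interior (cball 0 \<rho>)" using f(1) by (rule holomorphic_on_subset) simp
      show "cmod (f w) \<le> cmod (f z0)" if "w \<in> frontier (cball 0 \<rho>)" for w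
      proof -
        have "cmod w = \<rho>" using that r by simp
        then obtain x where "x \<in> cball 0 r" "w = \<Psi> x" using cover by blast
        then show ?thesis using z0(2) inv by simp
      qed
    qed (use contf z in auto)
  qed auto
  then show False using f(2) by blast
qed

text \<open>
The function \<open>w \<mapsto> (\<Psi> (r * w) - a) / (b - a)\<close>, where \<open>a\<close> and \<open>b\<close> are values of modulus \<open>2 * r\<close>
and \<open>4 * r\<close> omitted by \<open>\<Psi>\<close> on \<open>cball 0 r\<close>, omits \<open>0\<close> and \<open>1\<close> on the unit disc, and its value
at \<open>0\<close> is bounded independently of \<open>r\<close>. The theorem of Schottky therefore gives \<open>\<Psi>\<close> linear
growth.
\<close>

lemma entire_invariant_map_affine:
  fixes f \<Psi> :: "complex \<Rightarrow> complex"
  assumes f: "f holomorphic_on UNIV" "\<not> f constant_on UNIV"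
    and \<Psi>: "\<Psi> holomorphic_on UNIV" and inv: "\<And>z. f (\<Psi> z) = f z"
  obtains \<alpha> b where "\<And>z. \<Psi> z = \<alpha> * z + b"
proof -
  define C where "C = exp (pi * exp (pi * (2 + 2 * (3/2) + 12 * (1/2) / (1 - 1/2))))"
  have growth: "cmod (\<Psi> z) \<le> (4 + 12 * C) * cmod z ^ 1" if z: "cmod z \<ge> max 1 (cmod (\<Psi> 0))" for z
  proof -
    \<comment> \<open>The factor \<open>2\<close> puts \<open>z / r\<close> on the circle of radius \<open>1 / 2\<close>.\<close>
    define r where "r = 2 * cmod z"
    have r: "r > 0" "cmod (\<Psi> 0) \<le> r" using z by (auto simp: r_def)
    obtain a where a: "cmod a = 2 * r" "a \<notin> \<Psi> ` cball 0 r"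
      by (rule invariant_map_omits_point_on_circle[OF f inv, of r "2 * r"]) (use r in auto)
    obtain b where b: "cmod b = 4 * r" "b \<notin> \<Psi> ` cball 0 r"
      by (rule invariant_map_omits_point_on_circle[OF f inv, of r "4 * r"]) (use r in auto)
    have ba: "2 * r \<le> cmod (b - a)" "cmod (b - a) \<le> 6 * r"
      using norm_triangle_ineq2[of b a] norm_triangle_ineq4[of b a] a(1) b(1) by auto
    then have ba0: "0 < cmod (b - a)" "b \<noteq> a" using r by auto
    define g where "g = (\<lambda>w. (\<Psi> (of_real r * w) - a) / (b - a))"
    have "cmod (g (z / of_real r)) \<le> C"
      unfolding C_def
    proof (rule Schottky[where f = g])
      have "(\<lambda>w. \<Psi> (of_real r * w)) holomorphic_on UNIV"
        using holomorphic_on_compose_gen[of "\<lambda>w. of_real r * w" UNIV \<Psi> UNIV] \<Psi>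
        by (simp add: comp_def holomorphic_intros)
      then have "(\<lambda>w. \<Psi> (of_real r * w)) holomorphic_on cball 0 1"
        by (rule holomorphic_on_subset) simp
      then show "g holomorphic_on cball 0 1"
        unfolding g_def using ba0 by (intro holomorphic_intros) auto
      have "cmod (\<Psi> 0 - a) \<le> 3 * r"
        using norm_triangle_ineq4[of "\<Psi> 0" a] a(1) r(2) by linarith
      then have "cmod (\<Psi> 0 - a) \<le> 3 / 2 * cmod (b - a)" using ba by linarith
      then show "cmod (g 0) \<le> 3 / 2"
        using ba0 by (simp add: g_def norm_divide field_simps)
      show "\<not> (g w = 0 \<or> g w = 1)" if w: "w \<in> cball 0 1" for w
      proof -
        have "of_real r * w \<in> cball 0 r"
          using w r by (simp add: norm_mult)
        then have "\<Psi> (of_real r * w) \<noteq> a" "\<Psi> (of_real r * w) \<noteq> b" using a(2) b(2) by auto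
        then show ?thesis using ba0 by (simp add: g_def field_simps)
      qed
      show "cmod (z / of_real r) \<le> 1 / 2"
        using r by (simp add: norm_divide r_def)
    qed auto
    then have "cmod (\<Psi> z - a) \<le> C * cmod (b - a)"
      using ba0 r by (simp add: g_def norm_divide field_simps)
    also have "\<dots> \<le> C * (6 * r)"
      using ba by (intro mult_left_mono) (auto simp: C_def)
    finally have "cmod (\<Psi> z) \<le> C * (6 * r) + 2 * r"
      using norm_triangle_sub[of "\<Psi> z" a] a(1) by linarith
    then show ?thesis by (simp add: r_def algebra_simps)
  qed
  have series: "\<Psi> z = (\<Sum>k\<le>1. (deriv ^^ k) \<Psi> 0 / fact k * z ^ k)" for z
    by (rule Liouville_polynomial[OF \<Psi>]) (rule growth)
  have "\<Psi> z = deriv \<Psi> 0 * z + \<Psi> 0" for z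
    using series[of z] by simp
  then show ?thesis by (rule that)
qed

lemma linear_part_root_of_unity:
  fixes f :: "complex \<Rightarrow> complex"
  assumes f: "f holomorphic_on UNIV" and inv: "\<And>z. f (\<alpha> * z + b) = f z"
    and fixed: "\<alpha> * z0 + b = z0" and n: "(deriv ^^ n) f z0 \<noteq> 0"
  shows "\<alpha> ^ n = 1"
proof -
  have "(deriv ^^ n) (\<lambda>z. f (\<alpha> * z + b)) z0 = \<alpha> ^ n * (deriv ^^ n) f (\<alpha> * z0 + b)"
    by (rule higher_deriv_compose_linear'[OF f open_UNIV open_UNIV]) auto
  then show ?thesis using inv fixed n by simp
qed

text \<open>
The point \<open>b / (1 - \<alpha>)\<close> is the fixed point of the map, and the denominator of \<open>\<theta> / 2\<close> can be taken
to be the order to which \<open>f\<close> assumes its value there.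
\<close>

lemma affine_automorphism_classification:
  fixes f :: "complex \<Rightarrow> complex"
  assumes f: "f holomorphic_on UNIV" "\<not> f constant_on UNIV" and inv: "\<And>z. f (\<alpha> * z + b) = f z"
  shows "\<exists>\<theta>::real. \<theta> \<in> \<rat> \<and> \<alpha> = exp (\<i> * of_real (\<theta> * pi)) \<and>
    ((\<exists>m::int. \<theta> = 2 * of_int m) \<or>
     (let z0 = b / (1 - exp (\<i> * of_real (\<theta> * pi))) in
        deriv f z0 = 0 \<and>
        (\<forall>n::nat. n \<ge> 2 \<and> (\<forall>j\<in>{1..n - 1}. (deriv ^^ j) f z0 = 0) \<and> (deriv ^^ n) f z0 \<noteq> 0
           \<longrightarrow> \<theta> \<in> {2 * real k / real n | k. k \<in> {0..n - 1}})))"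
proof (cases "\<alpha> = 1")
  case True
  then show ?thesis by (intro exI[of _ 0]) auto
next
  case False
  define z0 where "z0 = b / (1 - \<alpha>)"
  have fixed: "\<alpha> * z0 + b = z0"
    using False by (simp add: z0_def field_simps)
  note root = linear_part_root_of_unity[OF f(1) inv fixed]
  obtain N where N: "N > 0" "(deriv ^^ N) f z0 \<noteq> 0" and least: "\<And>k. k < N \<Longrightarrow> \<not> (k > 0 \<and> (deriv ^^ k) f z0 \<noteq> 0)"
    using nonconstant_entire_higher_deriv_nonzero[OF f, of z0]
      exists_least_iff[of "\<lambda>n. n > 0 \<and> (deriv ^^ n) f z0 \<noteq> 0"] by blast
  have "\<alpha> \<in> {z. z ^ N = 1}" using root[OF N(2)] by simp
  then obtain j where j: "j < N" "\<alpha> = exp (2 * of_real pi * \<i> * of_nat j / of_nat N)"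
    using complex_roots_unity[of N] N(1) by auto
  define \<theta> where "\<theta> = 2 * real j / real N"
  have "\<theta> \<in> \<rat>" by (simp add: \<theta>_def)
  moreover have \<alpha>: "\<alpha> = exp (\<i> * of_real (\<theta> * pi))"
    unfolding j(2) \<theta>_def by (intro arg_cong[of _ _ exp]) (simp add: field_simps)
  moreover have "deriv f z0 = 0"
    using root[of 1] False by auto
  moreover have "\<theta> \<in> {2 * real k / real n | k. k \<in> {0..n - 1}}"
    if n: "n \<ge> 2" "\<forall>j\<in>{1..n - 1}. (deriv ^^ j) f z0 = 0" "(deriv ^^ n) f z0 \<noteq> 0" for n
  proof -
    have "\<not> n < N" using least[of n] n by auto
    moreover have "\<not> N < n"
    proof
      assume "N < n"
      then have "N \<in> {1..n - 1}" using N(1) by auto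
      then show False using n(2) N(2) by blast
    qed
    ultimately have "n = N" by simp
    then show ?thesis using j(1) unfolding \<theta>_def by (auto intro!: exI[of _ j])
  qed
  moreover have "b / (1 - exp (\<i> * of_real (\<theta> * pi))) = z0"
    unfolding z0_def by (simp only: \<alpha>[symmetric])
  ultimately show ?thesis
    unfolding Let_def by (intro exI[of _ \<theta>]) (simp only:, blast)
qed

theorem theorem2p4:
  fixes f :: "complex \<Rightarrow> complex" and \<Phi> :: "function_element set" and V :: "complex set"
  assumes "f holomorphic_on UNIV"
    and "\<not> f constant_on UNIV"
    and "\<Phi> \<in> Aut f"
    and "open V" and "V \<noteq> {}"
    and "uniform_over \<Phi> V"
  shows "\<exists>(\<theta>::real) (b::complex). \<theta> \<in> \<rat> \<and>
    (\<forall>z. branch_values \<Phi> z = {exp (\<i> * of_real (\<theta> * pi)) * z + b}) \<and>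
    ((\<exists>m::int. \<theta> = 2 * of_int m) \<or>
     (let z0 = b / (1 - exp (\<i> * of_real (\<theta> * pi))) in
        deriv f z0 = 0 \<and>
        (\<forall>n::nat. n \<ge> 2 \<and> (\<forall>j\<in>{1..n - 1}. (deriv ^^ j) f z0 = 0) \<and> (deriv ^^ n) f z0 \<noteq> 0
           \<longrightarrow> \<theta> \<in> {2 * real k / real n | k. k \<in> {0..n - 1}})))"
proof -
  interpret automorphic_branches f \<Phi>
    by standard (rule assms)+
  obtain c where c: "c \<in> V" using assms(5) by blast
  then obtain w where "branch_values \<Phi> c = {w}" using assms(6) unfolding uniform_over_def by blast
  then obtain a r \<phi> where \<phi>: "(a, r, \<phi>) \<in> \<Phi>" "c \<in> ball a r"
    unfolding branch_values_def by blast
  have "open (ball a r \<inter> V)" "c \<in> ball a r \<inter> V" using assms(4) c \<phi> by auto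
  then obtain \<delta> where \<delta>: "\<delta> > 0" "ball c \<delta> \<subseteq> ball a r \<inter> V" using openE by blast
  have single: "w = \<phi> z" if z: "z \<in> ball c \<delta>" and w: "w \<in> branch_values \<Phi> z" for z w
  proof -
    have "z \<in> V" "z \<in> ball a r" using z \<delta>(2) by auto
    then obtain v where v: "branch_values \<Phi> z = {v}" using assms(6) unfolding uniform_over_def by blast
    have "\<phi> z \<in> branch_values \<Phi> z"
      using \<phi>(1) \<open>z \<in> ball a r\<close> by (rule branch_valuesI)
    then show ?thesis using v w by simp
  qed
  have sub: "ball c \<delta> \<subseteq> ball a r" using \<delta>(2) by blast
  obtain \<Psi> where \<Psi>: "\<Psi> holomorphic_on UNIV" "\<And>z. z \<in> ball c \<delta> \<Longrightarrow> \<Psi> z = \<phi> z"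
    by (rule single_valued_branch_is_entire[OF \<phi>(1) sub \<delta>(1)]; (rule single, assumption+ | rule that))
  have \<phi>\<Psi>: "\<phi> z = \<Psi> z" if "z \<in> ball a r" for z
  proof (rule analytic_continuation_open[of "ball c \<delta>" "ball a r" \<phi> \<Psi>])
    show "\<Psi> holomorphic_on ball a r" using \<Psi>(1) by (rule holomorphic_on_subset) simp
  qed (use \<delta>(1) sub element_holomorphic(2)[OF \<phi>(1)] \<Psi>(2) that in auto)
  have bv: "branch_values \<Phi> z = {\<Psi> z}" for z
    using branches_of_entire_germ[OF \<Psi>(1) \<phi>(1) \<phi>\<Psi>] .
  then have inv: "f (\<Psi> z) = f z" for z
    using automorphic_value[of "\<Psi> z" z] by simp
  obtain \<alpha> b where \<alpha>: "\<And>z. \<Psi> z = \<alpha> * z + b"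
    using entire_invariant_map_affine[OF assms(1,2) \<Psi>(1) inv] by blast
  have "f (\<alpha> * z + b) = f z" for z using inv[of z] \<alpha> by simp
  from affine_automorphism_classification[OF assms(1,2) this]
  obtain \<theta> where \<theta>: "\<theta> \<in> \<rat>" "\<alpha> = exp (\<i> * of_real (\<theta> * pi))" and alternatives: "(\<exists>m::int. \<theta> = 2 * of_int m) \<or>
     (let z0 = b / (1 - exp (\<i> * of_real (\<theta> * pi))) in
        deriv f z0 = 0 \<and>
        (\<forall>n::nat. n \<ge> 2 \<and> (\<forall>j\<in>{1..n - 1}. (deriv ^^ j) f z0 = 0) \<and> (deriv ^^ n) f z0 \<noteq> 0
           \<longrightarrow> \<theta> \<in> {2 * real k / real n | k. k \<in> {0..n - 1}}))"
    by (elim exE conjE) (rule that)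
  have "branch_values \<Phi> z = {exp (\<i> * of_real (\<theta> * pi)) * z + b}" for z
    unfolding bv \<alpha> \<theta>(2) by (rule refl)
  with \<theta>(1) alternatives show ?thesis
    by (intro exI[of _ \<theta>] exI[of _ b] conjI allI)
qed

end
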